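(* In the Gaussian sequence model with the quadratic functional $Q(\theta)=\|\theta\|_2^2$, choose $k=o(n)$. Under the structure-agnostic model $\mathcal{P}_{\mathrm{SA}}(\hat\theta,r_n)$ with $r_n\ge C/n$ for some absolute constant $C>0$: (a) $\hat Q_{2,n}(k)$ is asymptotically minimax; (b) for every $\epsilon>0$ there exists a sufficiently large natural number $N$ (which may depend on $\epsilon$) such that for all $n\ge N$: (i) $\sup_{\mathbb{P}_\theta\in\mathcal{P}_{\mathrm{SA}}(\hat\theta,r_n)}\Delta_n(\hat Q_{2,n}(k),\hat Q_{1,n};\theta)\le\epsilon$ for any such $r_n$; and (ii) $\inf_{\mathbb{P}_\theta\in\mathcal{P}_{\mathrm{SA}}(\hat\theta,r_n)}\Delta_n(\hat Q_{2,n}(k),\hat Q_{1,n};\theta)<0$ if $r_n^2\ge C_1/n$ for some absolute constant $C_1>0$. Hence in case (ii) $\hat Q_{1,n}$ is (uniformly) asymptotically inadmissible in scaled MSE loss. The same conclusions also hold when $\mathcal{P}_{\mathrm{SA}}(\hat\theta,r_n)$ is replaced by the assumption-lean model $\mathcal{P}_{\mathrm{AL}}(\hat\theta)=\mathcal{P}_{\mathrm{SA}}(\hat\theta,R^* )$, for a given constant $R^*>0$, and the assumptions on $r_n$ are dropped.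
   Context: Model: one observes $Y=(Y_i)_{i\ge1}$ with $Y_i=\theta_i+\varepsilon_i$, $\varepsilon_i$ i.i.d. $N(0,1/n)$, $\theta=(\theta_i)_{i\ge1}$, $Q(\theta)=\sum_i\theta_i^2$; $\mathbb{P}_\theta$ is the law of the data. $\hat\theta$ is an initial estimator of $\theta$ treated as fixed (nonrandom), and $r_n$ is a rate nonincreasing in $n$; $\mathcal{P}_{\mathrm{SA}}(\hat\theta,r_n)=\{\mathbb{P}_\theta:\|\hat\theta-\theta\|_2^2\le r_n\}$. Estimators: $\hat Q_{1,n}=2\langle Y,\hat\theta\rangle-\|\hat\theta\|_2^2$, and $$\hat Q_{2,n}(k)=\hat Q_{1,n}+\sum_{i=1}^k\big(Y_{i,1}Y_{i,2}-2Y_i\hat\theta_i+\hat\theta_i^2\big),$$ where $Y_{i,1}=Y_i+\Phi^{-1}(U_i)/\sqrt n$, $Y_{i,2}=Y_i-\Phi^{-1}(U_i)/\sqrt n$, $\Phi$ is the standard normal c.d.f. and the $U_i$ are independent uniform random variables on $[0,1]$ (so that $Y_{i,1}$ and $Y_{i,2}$ are independent). For an estimator $\tilde Q$, $\mathrm{mse}(\tilde Q)=\mathbb{E}_\theta(\tilde Q-Q(\theta))^2$, and $\Delta_n(\tilde Q',\tilde Q;\theta)=\{\mathrm{mse}(\tilde Q')-\mathrm{mse}(\tilde Q)\}/\mathrm{mse}(\tilde Q)$. Asymptotically minimax means minimax rate-optimal: for large $n$ the supremum over the model of the MSE of the estimator is at most a constant times the minimax risk $\inf_{\tilde Q}\sup_{\mathbb{P}_\theta}\mathbb{E}_\theta(\tilde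 Q-Q(\theta))^2$ over the same model. (Known from prior literature: if $r_n\ge C/n$, the minimax risk over $\mathcal{P}_{\mathrm{SA}}(\hat\theta,r_n)$ is bounded below by a constant times $r_n^2+\|\hat\theta\|_2^2/n$.) Asymptotic inadmissibility: $\{\psi_n\}$ is (uniformly) asymptotically inadmissible in scaled MSE loss under a model if there is another estimator sequence $\{\psi_n'\}$ such that for every $\epsilon>0$ there is $N$ such that for all $n\ge N$ the supremum of $\Delta_n(\psi_n',\psi_n;\theta)$ over the model is $\le\epsilon$ and its infimum over the model is $<0$.
   Formalization: The initial estimator is assumed to have squared norm eventually bounded below by a positive constant (for fixed θ̂: θ̂ ≠ 0) and k ≥ 1 eventually; for θ̂ = 0 parts (b)(i) and inadmissibility fail, and for k = 0 part (ii) fails. *)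

theory Defs
  imports "HOL-Probability.Probability" "HOL-Library.Landau_Symbols"
begin

text \<open>
  Coordinates are indexed from 0: the entry at index \<open>i\<close> is the mathematical coordinate
  \<open>i + 1\<close>, so the first \<open>k\<close> coordinates are those with index in \<open>{..<k}\<close>.
\<close>

definition l2 :: "(nat \<Rightarrow> real) set" where
  "l2 = {\<theta>. summable (\<lambda>i. (\<theta> i)\<^sup>2)}"

definition sqnorm :: "(nat \<Rightarrow> real) \<Rightarrow> real" where
  "sqnorm \<theta> = (\<Sum>i. (\<theta> i)\<^sup>2)"

definition Q :: "(nat \<Rightarrow> real) \<Rightarrow> real" where
  "Q \<theta> = sqnorm \<theta>"

definition data_law :: "nat \<Rightarrow> (nat \<Rightarrow> real) \<Rightarrow> (nat \<Rightarrow> real) measure" where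
  "data_law n \<theta> =
     (\<Pi>\<^sub>M i\<in>UNIV. density lborel (\<lambda>x. ennreal (normal_density (\<theta> i) (1 / sqrt (real n)) x)))"

definition aux_law :: "(nat \<Rightarrow> real) measure" where
  "aux_law = (\<Pi>\<^sub>M i\<in>UNIV. uniform_measure lborel {0..1})"

text \<open>
  An outcome is a pair \<open>(Y, U)\<close> of the observed sequence and an independent sequence of
  uniform variables. Estimators may depend on both, i.e. they may be randomized; the
  infimum in the minimax risk ranges over all of them. As \<open>\<theta>\<close> is determined by the law of
  the data, a model is represented by its set of parameters.
\<close>

type_synonym outcome = "(nat \<Rightarrow> real) \<times> (nat \<Rightarrow> real)"

definition law :: "nat \<Rightarrow> (nat \<Rightarrow> real) \<Rightarrow> outcome measure" where
  "law n \<theta> = data_law n \<theta> \<Otimes>\<^sub>M aux_law"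

definition estimators :: "(outcome \<Rightarrow> real) set" where
  "estimators = borel_measurable ((\<Pi>\<^sub>M i\<in>UNIV. borel) \<Otimes>\<^sub>M (\<Pi>\<^sub>M i\<in>UNIV. borel))"

definition mse :: "nat \<Rightarrow> (outcome \<Rightarrow> real) \<Rightarrow> (nat \<Rightarrow> real) \<Rightarrow> ennreal" where
  "mse n T \<theta> = (\<integral>\<^sup>+ \<omega>. ennreal ((T \<omega> - Q \<theta>)\<^sup>2) \<partial>law n \<theta>)"

text \<open>Extended reals, because a competing estimator may have infinite mean squared error.\<close>

definition Delta ::
  "nat \<Rightarrow> (outcome \<Rightarrow> real) \<Rightarrow> (outcome \<Rightarrow> real) \<Rightarrow> (nat \<Rightarrow> real) \<Rightarrow> ereal" where
  "Delta n T' T \<theta> =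
     (enn2ereal (mse n T' \<theta>) - enn2ereal (mse n T \<theta>)) / enn2ereal (mse n T \<theta>)"

definition P_SA :: "(nat \<Rightarrow> real) \<Rightarrow> real \<Rightarrow> (nat \<Rightarrow> real) set" where
  "P_SA \<theta>h r = {\<theta> \<in> l2. sqnorm (\<lambda>i. \<theta>h i - \<theta> i) \<le> r}"

definition P_AL :: "real \<Rightarrow> (nat \<Rightarrow> real) \<Rightarrow> (nat \<Rightarrow> real) set" where
  "P_AL R \<theta>h = P_SA \<theta>h R"

definition rate :: "real \<Rightarrow> (nat \<Rightarrow> real) \<Rightarrow> bool" where
  "rate C r \<longleftrightarrow> antimono_on {1..} r \<and> (\<forall>n\<ge>1. C / real n \<le> r n)"

text \<open>
  For square-summable \<open>\<theta>\<close> and \<open>\<theta>h\<close> the series in \<open>Qhat1\<close> is in general only almost surely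
  convergent and not absolutely convergent; \<open>suminf\<close> is the limit of its partial sums.
\<close>

definition Qhat1 :: "(nat \<Rightarrow> real) \<Rightarrow> outcome \<Rightarrow> real" where
  "Qhat1 \<theta>h = (\<lambda>(Y, U). 2 * (\<Sum>i. Y i * \<theta>h i) - sqnorm \<theta>h)"

text \<open>The standard normal c.d.f. is a bijection of the reals onto the open interval
  \<open>(0, 1)\<close>, which has probability one under the uniform law; the value of
  \<open>Phi_inv\<close> elsewhere is irrelevant.\<close>

definition Phi :: "real \<Rightarrow> real" where
  "Phi = cdf std_normal_distribution"

definition Phi_inv :: "real \<Rightarrow> real" where
  "Phi_inv = the_inv Phi"

definition Y1 :: "nat \<Rightarrow> outcome \<Rightarrow> nat \<Rightarrow> real" where
  "Y1 n = (\<lambda>(Y, U) i. Y i + Phi_inv (U i) / sqrt (real n))"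

definition Y2 :: "nat \<Rightarrow> outcome \<Rightarrow> nat \<Rightarrow> real" where
  "Y2 n = (\<lambda>(Y, U) i. Y i - Phi_inv (U i) / sqrt (real n))"

definition Qhat2 :: "nat \<Rightarrow> (nat \<Rightarrow> real) \<Rightarrow> nat \<Rightarrow> outcome \<Rightarrow> real" where
  "Qhat2 n \<theta>h k = (\<lambda>\<omega>. Qhat1 \<theta>h \<omega> +
     (\<Sum>i<k. Y1 n \<omega> i * Y2 n \<omega> i - 2 * fst \<omega> i * \<theta>h i + (\<theta>h i)\<^sup>2))"

definition minimax_risk :: "nat \<Rightarrow> (nat \<Rightarrow> real) set \<Rightarrow> ennreal" where
  "minimax_risk n M = (INF T\<in>estimators. SUP \<theta>\<in>M. mse n T \<theta>)"

definition asymptotically_minimax ::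
  "(nat \<Rightarrow> outcome \<Rightarrow> real) \<Rightarrow> (nat \<Rightarrow> (nat \<Rightarrow> real) set) \<Rightarrow> bool" where
  "asymptotically_minimax T M \<longleftrightarrow>
     (\<forall>n. T n \<in> estimators) \<and>
     (\<exists>K::real. K > 0 \<and> (\<exists>N. \<forall>n\<ge>N.
        (SUP \<theta>\<in>M n. mse n (T n) \<theta>) \<le> ennreal K * minimax_risk n (M n)))"

definition asymptotically_inadmissible ::
  "(nat \<Rightarrow> outcome \<Rightarrow> real) \<Rightarrow> (nat \<Rightarrow> (nat \<Rightarrow> real) set) \<Rightarrow> bool" where
  "asymptotically_inadmissible T M \<longleftrightarrow>
     (\<exists>T'. (\<forall>n. T' n \<in> estimators) \<and>
       (\<forall>\<epsilon>::real. \<epsilon> > 0 \<longrightarrow> (\<exists>N. \<forall>n\<ge>N.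
          (SUP \<theta>\<in>M n. Delta n (T' n) (T n) \<theta>) \<le> ereal \<epsilon> \<and>
          (INF \<theta>\<in>M n. Delta n (T' n) (T n) \<theta>) < 0)))"

end

theory Submission
  imports Defs "HOL-Real_Asymp.Real_Asymp"
begin

text \<open>
  For \<open>\<delta> = \<theta>h - \<theta>\<close> the error of \<open>Qhat2\<close> is minus the tail \<open>\<Sum>i\<ge>k. (\<delta> i)\<^sup>2\<close> plus an almost surely
  convergent series of independent centered terms, so its mean squared error has a closed form;
  \<open>Qhat1\<close> is the case \<open>k = 0\<close>. Passing from \<open>Qhat1\<close> to \<open>Qhat2\<close> removes the square of
  \<open>h = \<Sum>i<k. (\<delta> i)\<^sup>2\<close> from the squared bias, and \<open>h\<^sup>2\<close> together with a small multiple of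
  \<open>sqnorm \<theta>h / n\<close> absorbs the increase of the variance. The minimax lower bound
  comes from two instances of Le Cam's method: \<open>r\<^sup>2\<close> by mixing many shifts of single coordinates,
  and \<open>sqnorm \<theta>h / n\<close> by a shift along a truncation of \<open>\<theta>h\<close>.
\<close>

subsection \<open>Series of independent centered variables\<close>

text \<open>The eventual bound \<open>h0\<close> on \<open>sqnorm (\<theta>h n)\<close> gives
  \<open>Qhat1\<close> a mean squared error of at least 4 h0 / n. Measured against this, the cost 4
  k / n^2 of the correction is negligible exactly because k = o(n). With \<open>k n = 0\<close> the
  two estimators coincide, so a strict gain needs at least one corrected coordinate. A single shift
  of squared size r can be detected once r is much larger than 1/n, which is why the bound of order
  r^2 needs a mixture; the bound of order \<open>sqnorm \<theta>h / n\<close> uses one shift of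
  squared size at most 1/n. Both go through one inequality between squares that involves only the
  first two moments of the likelihood ratio. No total variation distance appears, and randomized
  competitors with infinite error are covered.\<close>

lemma nn_integral_square_limit:
  fixes X :: "nat \<Rightarrow> 'a \<Rightarrow> real"
  assumes [measurable]: "\<And>m. X m \<in> borel_measurable N" "Z \<in> borel_measurable N"
    and lim: "AE \<omega> in N. (\<lambda>m. X m \<omega>) \<longlonglongrightarrow> Z \<omega>"
    and diff: "\<And>m l. m \<le> l \<Longrightarrow> (\<integral>\<^sup>+\<omega>. ennreal ((X l \<omega> - X m \<omega>)\<^sup>2) \<partial>N) \<le> ennreal (\<tau> m)"
    and \<tau>: "\<And>m. 0 \<le> \<tau> m" "\<tau> \<longlonglongrightarrow> 0"
    and sq: "\<And>m. (\<integral>\<^sup>+\<omega>. ennreal ((X m \<omega>)\<^sup>2) \<partial>N) = ennreal (c m)"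
    and c: "\<And>m. 0 \<le> c m" "c \<longlonglongrightarrow> d"
  shows "(\<integral>\<^sup>+\<omega>. ennreal ((Z \<omega>)\<^sup>2) \<partial>N) = ennreal d"
proof -
  have d0: "0 \<le> d"
    using c by (auto intro: LIMSEQ_le_const)
  \<comment> \<open>Applied with \<open>g\<close> equal to 0 for the upper bound, and with
    \<open>g = X m\<close> for the distance between the limit and \<open>X m\<close>.\<close>
  have fatou: "(\<integral>\<^sup>+\<omega>. ennreal ((Z \<omega> - g \<omega>)\<^sup>2) \<partial>N)
      \<le> liminf (\<lambda>m. \<integral>\<^sup>+\<omega>. ennreal ((X m \<omega> - g \<omega>)\<^sup>2) \<partial>N)"
    if [measurable]: "g \<in> borel_measurable N" for g
  proof -
    have "(\<integral>\<^sup>+\<omega>. ennreal ((Z \<omega> - g \<omega>)\<^sup>2) \<partial>N)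
        = (\<integral>\<^sup>+\<omega>. liminf (\<lambda>m. ennreal ((X m \<omega> - g \<omega>)\<^sup>2)) \<partial>N)"
    proof (rule nn_integral_cong_AE)
      show "AE \<omega> in N. ennreal ((Z \<omega> - g \<omega>)\<^sup>2) = liminf (\<lambda>m. ennreal ((X m \<omega> - g \<omega>)\<^sup>2))"
        using lim
      proof eventually_elim
        case (elim \<omega>)
        then have "(\<lambda>m. ennreal ((X m \<omega> - g \<omega>)\<^sup>2)) \<longlonglongrightarrow> ennreal ((Z \<omega> - g \<omega>)\<^sup>2)"
          by (intro tendsto_intros)
        then show ?case
          by (rule lim_imp_Liminf[OF sequentially_bot, symmetric])
      qed
    qed
    also have "\<dots> \<le> liminf (\<lambda>m. \<integral>\<^sup>+\<omega>. ennreal ((X m \<omega> - g \<omega>)\<^sup>2) \<partial>N)"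
      by (rule nn_integral_liminf) simp
    finally show ?thesis .
  qed
  have upper: "(\<integral>\<^sup>+\<omega>. ennreal ((Z \<omega>)\<^sup>2) \<partial>N) \<le> ennreal d"
  proof -
    have "(\<lambda>m. ennreal (c m)) \<longlonglongrightarrow> ennreal d"
      by (intro tendsto_ennrealI c)
    then have "liminf (\<lambda>m. ennreal (c m)) = ennreal d"
      by (rule lim_imp_Liminf[OF sequentially_bot])
    with fatou[of "\<lambda>_. 0"] show ?thesis
      by (simp add: sq)
  qed
  \<comment> \<open>The upper bound makes the integral finite, so the lower bound can be argued in
    the reals.\<close>
  then obtain I where I: "(\<integral>\<^sup>+\<omega>. ennreal ((Z \<omega>)\<^sup>2) \<partial>N) = ennreal I" "0 \<le> I"
    by (metis ennreal_cases top.not_eq_extremum ennreal_less_top leD)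
  have rest: "(\<integral>\<^sup>+\<omega>. ennreal ((Z \<omega> - X m \<omega>)\<^sup>2) \<partial>N) \<le> ennreal (\<tau> m)" for m
  proof -
    have "(\<integral>\<^sup>+\<omega>. ennreal ((Z \<omega> - X m \<omega>)\<^sup>2) \<partial>N)
        \<le> liminf (\<lambda>l. \<integral>\<^sup>+\<omega>. ennreal ((X l \<omega> - X m \<omega>)\<^sup>2) \<partial>N)"
      by (rule fatou) simp
    also have "\<dots> \<le> liminf (\<lambda>l. ennreal (\<tau> m))"
      by (intro Liminf_mono eventually_sequentiallyI[of m] diff)
    also have "\<dots> = ennreal (\<tau> m)"
      by (simp add: Liminf_const)
    finally show ?thesis .
  qed
  have "d \<le> (1 + \<eta>) * I" if \<eta>: "\<eta> > 0" for \<eta> :: real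
  proof -
    have "c m \<le> (1 + \<eta>) * I + (1 + 1 / \<eta>) * \<tau> m" for m
    proof -
      \<comment> \<open>Young's inequality with weight \<open>\<eta>\<close>: replacing x by z costs
        a factor close to 1 and a multiple of the squared distance. The distance term vanishes as m
        grows, and only then is \<open>\<eta>\<close> sent to 0.\<close>
      have pt: "x\<^sup>2 \<le> (1 + \<eta>) * z\<^sup>2 + (1 + 1 / \<eta>) * (z - x)\<^sup>2" for x z :: real
      proof -
        have "(1 + \<eta>) * z\<^sup>2 + (1 + 1 / \<eta>) * (z - x)\<^sup>2 - x\<^sup>2
            = (\<eta> * z + (z - x))\<^sup>2 / \<eta>"
          using \<eta> by (simp add: field_simps power2_eq_square)
        moreover have "\<dots> \<ge> 0"
          using \<eta> by simp
        ultimately show ?thesis by linarith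
      qed
      have "ennreal (c m) \<le> (\<integral>\<^sup>+\<omega>. ennreal (1 + \<eta>) * ennreal ((Z \<omega>)\<^sup>2)
          + ennreal (1 + 1 / \<eta>) * ennreal ((Z \<omega> - X m \<omega>)\<^sup>2) \<partial>N)"
        unfolding sq[symmetric]
      proof (rule nn_integral_mono)
        fix \<omega>
        show "ennreal ((X m \<omega>)\<^sup>2) \<le> ennreal (1 + \<eta>) * ennreal ((Z \<omega>)\<^sup>2)
          + ennreal (1 + 1 / \<eta>) * ennreal ((Z \<omega> - X m \<omega>)\<^sup>2)"
          using \<eta> pt[of "X m \<omega>" "Z \<omega>"]
          by (simp add: ennreal_mult[symmetric] ennreal_plus[symmetric] ennreal_leI del: ennreal_plus)
      qed
      also have "\<dots> = ennreal (1 + \<eta>) * ennreal I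
          + ennreal (1 + 1 / \<eta>) * (\<integral>\<^sup>+\<omega>. ennreal ((Z \<omega> - X m \<omega>)\<^sup>2) \<partial>N)"
        by (simp add: nn_integral_add nn_integral_cmult I)
      also have "\<dots> \<le> ennreal (1 + \<eta>) * ennreal I + ennreal (1 + 1 / \<eta>) * ennreal (\<tau> m)"
        by (intro add_left_mono mult_left_mono rest) simp
      also have "\<dots> = ennreal ((1 + \<eta>) * I + (1 + 1 / \<eta>) * \<tau> m)"
        using \<eta> I \<tau> by (simp add: ennreal_mult ennreal_plus)
      finally show ?thesis
        using \<eta> I \<tau> by (subst (asm) ennreal_le_iff) auto
    qed
    moreover have "(\<lambda>m. (1 + \<eta>) * I + (1 + 1 / \<eta>) * \<tau> m) \<longlonglongrightarrow> (1 + \<eta>) * I + (1 + 1 / \<eta>) * 0"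
      by (intro tendsto_intros \<tau>)
    ultimately show ?thesis
      using c(2) by (simp add: LIMSEQ_le)
  qed
  then have "\<And>m. d \<le> (1 + inverse (real (Suc m))) * I"
    by simp
  moreover have "(\<lambda>m. (1 + inverse (real (Suc m))) * I) \<longlonglongrightarrow> (1 + 0) * I"
    by (intro tendsto_intros LIMSEQ_inverse_real_of_nat)
  ultimately have "d \<le> I"
    using LIMSEQ_le_const by fastforce
  then show ?thesis
    using upper by (simp add: I antisym ennreal_leI)
qed

text \<open>Validity of \<open>shifted_square\<close> for every \<open>x\<close> says at once that
  \<open>p i\<close> has mean zero and variance \<open>v i\<close>, as an identity between
  nonnegative integrals that carries no integrability side conditions. The free shift
  \<open>x\<close> absorbs whatever the other coordinates contribute, so independence is used
  through Fubini alone.\<close>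

locale centered_square_sequence = product_prob_space M UNIV for M :: "nat \<Rightarrow> 'a measure" +
  fixes p :: "nat \<Rightarrow> 'a \<Rightarrow> real" and v :: "nat \<Rightarrow> real"
  assumes p_measurable [measurable]: "\<And>i. p i \<in> borel_measurable (M i)"
    and v_nonneg: "\<And>i. 0 \<le> v i"
    and shifted_square: "\<And>i x. (\<integral>\<^sup>+y. ennreal ((x + p i y)\<^sup>2) \<partial>M i) = ennreal (x\<^sup>2 + v i)"
begin

lemma shifted_square_add:
  assumes "0 \<le> c"
  shows "(\<integral>\<^sup>+y. ennreal ((x + p i y)\<^sup>2 + c) \<partial>M i) = ennreal (x\<^sup>2 + v i + c)"
  using assms
  by (simp add: nn_integral_add shifted_square M.emeasure_space_1 v_nonneg)

lemma nn_integral_restrict: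
  assumes "finite J" and f: "f \<in> borel_measurable (PiM J M)"
  shows "(\<integral>\<^sup>+\<omega>. f (restrict \<omega> J) \<partial>PiM UNIV M) = (\<integral>\<^sup>+\<omega>. f \<omega> \<partial>PiM J M)"
  using nn_integral_distr[of "\<lambda>x. restrict x J" "PiM UNIV M" "PiM J M" f]
    distr_PiM_restrict_finite[of J] assms
  by (simp add: measurable_restrict_subset)

lemma shifted_square_finite_sum:
  assumes "finite J"
  shows "(\<integral>\<^sup>+\<omega>. ennreal ((x + (\<Sum>i\<in>J. p i (\<omega> i)))\<^sup>2) \<partial>PiM J M) = ennreal (x\<^sup>2 + sum v J)"
  using assms
proof (induction J arbitrary: x)
  case empty
  interpret J: prob_space "PiM {} M"
    by (intro prob_space_PiM prob_space)
  show ?case by (simp add: J.emeasure_space_1)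
next
  case (insert j J)
  interpret J: prob_space "PiM J M"
    by (intro prob_space_PiM prob_space)
  \<comment> \<open>The new coordinate is integrated outermost: for fixed \<open>y\<close> it merely
    moves the starting point, and the induction hypothesis applies at
    \<open>x + p j y\<close>.\<close>
  have upd: "(\<Sum>i\<in>insert j J. p i ((\<omega> (j := y)) i)) = p j y + (\<Sum>i\<in>J. p i (\<omega> i))" for \<omega> y
    using insert.hyps by (auto intro!: sum.cong)
  have "(\<integral>\<^sup>+\<omega>. ennreal ((x + (\<Sum>i\<in>insert j J. p i (\<omega> i)))\<^sup>2) \<partial>PiM (insert j J) M)
      = (\<integral>\<^sup>+y. (\<integral>\<^sup>+\<omega>. ennreal (((x + p j y) + (\<Sum>i\<in>J. p i (\<omega> i)))\<^sup>2) \<partial>PiM J M) \<partial>M j)"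
    by (subst product_nn_integral_insert_rev[OF insert.hyps]) (simp_all only: upd add.assoc[symmetric], measurable)
  also have "\<dots> = ennreal (x\<^sup>2 + sum v (insert j J))"
    using insert.hyps by (simp add: insert.IH shifted_square_add sum_nonneg v_nonneg add.assoc[of _ "v j"] del: ennreal_plus)
  finally show ?case .
qed

lemma shifted_square_partial_sum:
  assumes "finite J"
  shows "(\<integral>\<^sup>+\<omega>. ennreal ((x + (\<Sum>i\<in>J. p i (\<omega> i)))\<^sup>2) \<partial>PiM UNIV M) = ennreal (x\<^sup>2 + sum v J)"
proof -
  have "(\<integral>\<^sup>+\<omega>. ennreal ((x + (\<Sum>i\<in>J. p i (\<omega> i)))\<^sup>2) \<partial>PiM UNIV M)
    = (\<integral>\<^sup>+\<omega>. ennreal ((x + (\<Sum>i\<in>J. p i (restrict \<omega> J i)))\<^sup>2) \<partial>PiM UNIV M)"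
    by (intro nn_integral_cong arg_cong[where f = ennreal] arg_cong[where f = "\<lambda>z. (x + z)\<^sup>2"] sum.cong) auto
  also have "\<dots> = (\<integral>\<^sup>+\<omega>. ennreal ((x + (\<Sum>i\<in>J. p i (\<omega> i)))\<^sup>2) \<partial>PiM J M)"
    by (rule nn_integral_restrict[OF assms]) measurable
  finally show ?thesis
    using shifted_square_finite_sum[OF assms] by simp
qed

text \<open>Kolmogorov's maximal inequality. Carrying the arbitrary starting point \<open>x\<close> lets the
  induction peel off the first coordinate by Fubini, so that no stopping time is needed.\<close>

lemma maximal_inequality_finite:
  assumes e: "0 < e" and "a \<le> b"
  shows "ennreal (e\<^sup>2) * (\<integral>\<^sup>+\<omega>. of_bool (\<exists>k\<in>{a..b}. e \<le> \<bar>x + (\<Sum>i\<in>{a..<k}. p i (\<omega> i))\<bar>) \<partial>PiM {a..<b} M)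
    \<le> ennreal (x\<^sup>2 + sum v {a..<b})"
  using \<open>a \<le> b\<close>
proof (induction "b - a" arbitrary: a x)
  case 0
  then have [simp]: "a = b" by simp
  have "e\<^sup>2 \<le> x\<^sup>2" if "e \<le> \<bar>x\<bar>"
    using that e by (metis abs_le_square_iff abs_of_pos)
  interpret J: prob_space "PiM {} M"
    by (intro prob_space_PiM prob_space)
  show ?case
    using \<open>e \<le> \<bar>x\<bar> \<Longrightarrow> e\<^sup>2 \<le> x\<^sup>2\<close> by (auto simp add: J.emeasure_space_1 ennreal_leI of_bool_def)
next
  case (Suc l)
  then have ab: "Suc a \<le> b" "l = b - Suc a" by simp_all
  interpret J: prob_space "PiM {Suc a..<b} M"
    by (intro prob_space_PiM prob_space)
  interpret J': prob_space "PiM {a..<b} M"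
    by (intro prob_space_PiM prob_space)
  show ?case
  proof (cases "e \<le> \<bar>x\<bar>")
    \<comment> \<open>The starting point itself is outside, so the trivial bound 1 on the
      probability is enough: the right-hand side already contains x^2, which is at least
      e^2.\<close>
    case True
    have "(\<integral>\<^sup>+\<omega>. of_bool (\<exists>k\<in>{a..b}. e \<le> \<bar>x + (\<Sum>i\<in>{a..<k}. p i (\<omega> i))\<bar>) \<partial>PiM {a..<b} M)
        \<le> (\<integral>\<^sup>+\<omega>. 1 \<partial>PiM {a..<b} M)"
      by (intro nn_integral_mono) (auto simp: of_bool_def)
    then have "(\<integral>\<^sup>+\<omega>. of_bool (\<exists>k\<in>{a..b}. e \<le> \<bar>x + (\<Sum>i\<in>{a..<k}. p i (\<omega> i))\<bar>) \<partial>PiM {a..<b} M) \<le> 1"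
      by (simp add: J'.emeasure_space_1)
    then have "ennreal (e\<^sup>2) * (\<integral>\<^sup>+\<omega>. of_bool (\<exists>k\<in>{a..b}. e \<le> \<bar>x + (\<Sum>i\<in>{a..<k}. p i (\<omega> i))\<bar>) \<partial>PiM {a..<b} M)
        \<le> ennreal (e\<^sup>2) * 1"
      by (intro mult_left_mono) auto
    also have "\<dots> \<le> ennreal (x\<^sup>2 + sum v {a..<b})"
    proof -
      have "e\<^sup>2 \<le> x\<^sup>2"
        using True e by (metis abs_le_square_iff abs_of_pos)
      then show ?thesis
        by (simp add: ennreal_leI add_increasing2 sum_nonneg v_nonneg)
    qed
    finally show ?thesis .
  next
    case False
    have set_eq: "{a..<b} = insert a {Suc a..<b}"
      using ab by auto
    \<comment> \<open>Since \<bar>x\<bar> < e, the index \<open>k = a\<close> is never the witness,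
      and the event becomes the same event for the walk that starts one coordinate later at
      \<open>x + p a y\<close>.\<close>
    have upd: "(\<exists>k\<in>{a..b}. e \<le> \<bar>x + (\<Sum>i\<in>{a..<k}. p i ((\<omega> (a := y)) i))\<bar>)
      \<longleftrightarrow> (\<exists>k\<in>{Suc a..b}. e \<le> \<bar>(x + p a y) + (\<Sum>i\<in>{Suc a..<k}. p i (\<omega> i))\<bar>)" for \<omega> y
    proof -
      have split: "x + (\<Sum>i\<in>{a..<k}. p i ((\<omega> (a := y)) i)) = (x + p a y) + (\<Sum>i\<in>{Suc a..<k}. p i (\<omega> i))"
        if "Suc a \<le> k" for k
        using that by (subst sum.atLeast_Suc_lessThan) (auto intro!: sum.cong)
      have "(\<exists>k\<in>{a..b}. e \<le> \<bar>x + (\<Sum>i\<in>{a..<k}. p i ((\<omega> (a := y)) i))\<bar>)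
        \<longleftrightarrow> (\<exists>k\<in>{Suc a..b}. e \<le> \<bar>x + (\<Sum>i\<in>{a..<k}. p i ((\<omega> (a := y)) i))\<bar>)"
        using False ab by (auto simp: Bex_def le_Suc_eq Suc_le_eq nat_less_le)
      then show ?thesis
        using split by (metis (no_types, lifting) atLeastAtMost_iff)
    qed
    let ?F = "\<lambda>\<omega>. of_bool (\<exists>k\<in>{a..b}. e \<le> \<bar>x + (\<Sum>i\<in>{a..<k}. p i (\<omega> i))\<bar>) :: ennreal"
    have meas: "(\<lambda>\<omega>. of_bool (\<exists>k\<in>{a..b}. e \<le> \<bar>x + (\<Sum>i\<in>{a..<k}. p i (\<omega> i))\<bar>) :: ennreal)
        \<in> borel_measurable (PiM (insert a {Suc a..<b}) M)"
    proof -
      have [measurable]: "(\<lambda>\<omega>. \<Sum>i\<in>{a..<k}. p i (\<omega> i)) \<in> borel_measurable (PiM (insert a {Suc a..<b}) M)"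
        if "k \<le> b" for k
      proof (rule borel_measurable_sum)
        fix i assume "i \<in> {a..<k}"
        then have [measurable]: "i \<in> insert a {Suc a..<b}" using that by auto
        show "(\<lambda>\<omega>. p i (\<omega> i)) \<in> borel_measurable (PiM (insert a {Suc a..<b}) M)"
          by measurable
      qed
      have "Measurable.pred (PiM (insert a {Suc a..<b}) M) (\<lambda>\<omega>. \<exists>k\<in>{a..b}. e \<le> \<bar>x + (\<Sum>i\<in>{a..<k}. p i (\<omega> i))\<bar>)"
        by (intro pred_intros_finite) auto
      then show ?thesis
        by (auto simp: of_bool_def)
    qed
    have "ennreal (e\<^sup>2) * (\<integral>\<^sup>+\<omega>. of_bool (\<exists>k\<in>{a..b}. e \<le> \<bar>x + (\<Sum>i\<in>{a..<k}. p i (\<omega> i))\<bar>) \<partial>PiM {a..<b} M)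
      = (\<integral>\<^sup>+y. ennreal (e\<^sup>2) * (\<integral>\<^sup>+\<omega>. of_bool (\<exists>k\<in>{Suc a..b}. e \<le> \<bar>(x + p a y) + (\<Sum>i\<in>{Suc a..<k}. p i (\<omega> i))\<bar>) \<partial>PiM {Suc a..<b} M) \<partial>M a)"
    proof -
      have "ennreal (e\<^sup>2) * integral\<^sup>N (PiM {a..<b} M) ?F = (\<integral>\<^sup>+\<omega>. ennreal (e\<^sup>2) * ?F \<omega> \<partial>PiM (insert a {Suc a..<b}) M)"
        unfolding set_eq using meas by (rule nn_integral_cmult[symmetric])
      also have "\<dots> = (\<integral>\<^sup>+y. (\<integral>\<^sup>+\<omega>. ennreal (e\<^sup>2) * ?F (\<omega> (a := y)) \<partial>PiM {Suc a..<b} M) \<partial>M a)"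
        using meas by (intro product_nn_integral_insert_rev) auto
      also have "\<dots> = (\<integral>\<^sup>+y. ennreal (e\<^sup>2) * (\<integral>\<^sup>+\<omega>. ?F (\<omega> (a := y)) \<partial>PiM {Suc a..<b} M) \<partial>M a)"
      proof (intro nn_integral_cong nn_integral_cmult)
        fix y assume y: "y \<in> space (M a)"
        have "(\<lambda>\<omega>. \<omega> (a := y)) \<in> PiM {Suc a..<b} M \<rightarrow>\<^sub>M PiM (insert a {Suc a..<b}) M"
          using y by (intro measurable_fun_upd[where J = "{Suc a..<b}"]) auto
        from measurable_compose[OF this meas]
        show "(\<lambda>\<omega>. ?F (\<omega> (a := y))) \<in> borel_measurable (PiM {Suc a..<b} M)" .
      qed
      finally show ?thesis by (simp only: upd)
    qed
    also have "\<dots> \<le> (\<integral>\<^sup>+y. ennreal ((x + p a y)\<^sup>2 + sum v {Suc a..<b}) \<partial>M a)"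
      using ab by (intro nn_integral_mono Suc.hyps) auto
    also have "\<dots> = ennreal (x\<^sup>2 + sum v {a..<b})"
      using ab by (simp add: shifted_square_add sum_nonneg v_nonneg sum.atLeast_Suc_lessThan[of a b] add.assoc del: ennreal_plus)
    finally show ?thesis .
  qed
qed

lemma maximal_inequality:
  assumes e: "0 < e" and "a \<le> b"
  shows "ennreal (e\<^sup>2) * emeasure (PiM UNIV M) {\<omega>\<in>space (PiM UNIV M). \<exists>k\<in>{a..b}. e \<le> \<bar>\<Sum>i\<in>{a..<k}. p i (\<omega> i)\<bar>}
    \<le> ennreal (sum v {a..<b})"
proof -
  let ?F = "\<lambda>\<omega>. of_bool (\<exists>k\<in>{a..b}. e \<le> \<bar>0 + (\<Sum>i\<in>{a..<k}. p i (\<omega> i))\<bar>) :: ennreal"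
  have meas: "?F \<in> borel_measurable (PiM {a..<b} M)"
  proof -
    have [measurable]: "(\<lambda>\<omega>. \<Sum>i\<in>{a..<k}. p i (\<omega> i)) \<in> borel_measurable (PiM {a..<b} M)"
      if "k \<le> b" for k
    proof (rule borel_measurable_sum)
      fix i assume "i \<in> {a..<k}"
      then have [measurable]: "i \<in> {a..<b}" using that by auto
      show "(\<lambda>\<omega>. p i (\<omega> i)) \<in> borel_measurable (PiM {a..<b} M)"
        by measurable
    qed
    have "Measurable.pred (PiM {a..<b} M) (\<lambda>\<omega>. \<exists>k\<in>{a..b}. e \<le> \<bar>0 + (\<Sum>i\<in>{a..<k}. p i (\<omega> i))\<bar>)"
      by (intro pred_intros_finite) auto
    then show ?thesis
      by (auto simp: of_bool_def)
  qed
  have "emeasure (PiM UNIV M) {\<omega>\<in>space (PiM UNIV M). \<exists>k\<in>{a..b}. e \<le> \<bar>\<Sum>i\<in>{a..<k}. p i (\<omega> i)\<bar>}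
      = (\<integral>\<^sup>+\<omega>. indicator {\<omega>\<in>space (PiM UNIV M). \<exists>k\<in>{a..b}. e \<le> \<bar>\<Sum>i\<in>{a..<k}. p i (\<omega> i)\<bar>} \<omega> \<partial>PiM UNIV M)"
    by (rule nn_integral_indicator[symmetric]) measurable
  also have "\<dots> = (\<integral>\<^sup>+\<omega>. ?F (restrict \<omega> {a..<b}) \<partial>PiM UNIV M)"
  proof (rule nn_integral_cong)
    fix \<omega> assume "\<omega> \<in> space (PiM UNIV M)"
    have "(\<Sum>i\<in>{a..<k}. p i (restrict \<omega> {a..<b} i)) = (\<Sum>i\<in>{a..<k}. p i (\<omega> i))" if "k \<in> {a..b}" for k
      using that by (intro sum.cong) auto
    then have "(\<exists>k\<in>{a..b}. e \<le> \<bar>0 + (\<Sum>i\<in>{a..<k}. p i (restrict \<omega> {a..<b} i))\<bar>)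
        \<longleftrightarrow> (\<exists>k\<in>{a..b}. e \<le> \<bar>\<Sum>i\<in>{a..<k}. p i (\<omega> i)\<bar>)"
      by (intro bex_cong) auto
    then show "indicator {\<omega>\<in>space (PiM UNIV M). \<exists>k\<in>{a..b}. e \<le> \<bar>\<Sum>i\<in>{a..<k}. p i (\<omega> i)\<bar>} \<omega>
        = ?F (restrict \<omega> {a..<b})"
      using \<open>\<omega> \<in> space (PiM UNIV M)\<close>
      by (simp only: indicator_def mem_Collect_eq simp_thms)
  qed
  also have "\<dots> = integral\<^sup>N (PiM {a..<b} M) ?F"
    using meas by (rule nn_integral_restrict[rotated]) simp
  finally show ?thesis
    using maximal_inequality_finite[OF assms, of 0] by simp
qed

text \<open>The bad set \<open>N\<close> lies, for every start \<open>a\<close>, in the event that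
  some partial sum from \<open>a\<close> on reaches size \<open>e\<close>. The maximal inequality
  bounds that event by \<open>t a / e^2\<close>, where \<open>t a\<close> is the tail of the
  variance series, and this tends to 0.\<close>

lemma AE_tail_sums_small:
  assumes e: "0 < e" and "summable v"
  shows "AE \<omega> in PiM UNIV M. \<exists>m. \<forall>k\<ge>m. \<bar>\<Sum>i\<in>{m..<k}. p i (\<omega> i)\<bar> < e"
proof -
  let ?P = "PiM UNIV M"
  define B where "B a b = {\<omega>\<in>space ?P. \<exists>k\<in>{a..b}. e \<le> \<bar>\<Sum>i\<in>{a..<k}. p i (\<omega> i)\<bar>}" for a b
  have [measurable]: "B a b \<in> sets ?P" for a b
    unfolding B_def by measurable
  define N where "N = {\<omega>\<in>space ?P. \<forall>m. \<exists>k\<ge>m. e \<le> \<bar>\<Sum>i\<in>{m..<k}. p i (\<omega> i)\<bar>}"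
  have N_sets [measurable]: "N \<in> sets ?P"
    unfolding N_def by measurable
  define t where "t a = suminf v - sum v {..<a}" for a
  have bound: "ennreal (e\<^sup>2) * emeasure ?P (\<Union>l. B a (a + l)) \<le> ennreal (t a)" for a
  proof -
    have "emeasure ?P (\<Union>l. B a (a + l)) = (SUP l. emeasure ?P (B a (a + l)))"
      by (rule SUP_emeasure_incseq[symmetric]) (auto simp: incseq_def B_def)
    moreover have "ennreal (e\<^sup>2) * emeasure ?P (B a (a + l)) \<le> ennreal (t a)" for l
    proof -
      have "ennreal (e\<^sup>2) * emeasure ?P (B a (a + l)) \<le> ennreal (sum v {a..<a + l})"
        unfolding B_def using e by (intro maximal_inequality) auto
      also have "sum v {a..<a + l} = sum v {..<a + l} - sum v {..<a}"
        by (simp add: lessThan_atLeast0 sum_diff_nat_ivl)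
      also have "\<dots> \<le> t a"
        unfolding t_def using assms(2) v_nonneg by (simp add: sum_le_suminf)
      finally show ?thesis
        by (simp add: ennreal_leI)
    qed
    ultimately show ?thesis
      by (simp add: SUP_mult_left_ennreal SUP_le_iff)
  qed
  have "ennreal (e\<^sup>2) * emeasure ?P N \<le> ennreal (t a)" for a
  proof -
    have "N \<subseteq> (\<Union>l. B a (a + l))"
    proof
      fix \<omega> assume "\<omega> \<in> N"
      then obtain k where "k \<ge> a" "e \<le> \<bar>\<Sum>i\<in>{a..<k}. p i (\<omega> i)\<bar>" "\<omega> \<in> space ?P"
        unfolding N_def by auto
      then have "\<omega> \<in> B a (a + (k - a))"
        unfolding B_def by auto
      then show "\<omega> \<in> (\<Union>l. B a (a + l))" by blast
    qed
    then have "emeasure ?P N \<le> emeasure ?P (\<Union>l. B a (a + l))"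
      by (intro emeasure_mono) auto
    then show ?thesis
      using bound[of a] by (meson mult_left_mono order_trans zero_le)
  qed
  moreover have "(\<lambda>a. ennreal (t a)) \<longlonglongrightarrow> ennreal 0"
    unfolding t_def using summable_LIMSEQ[OF assms(2)]
    by (intro tendsto_ennrealI) (auto intro!: tendsto_eq_intros)
  ultimately have "ennreal (e\<^sup>2) * emeasure ?P N \<le> 0"
    using LIMSEQ_le_const by fastforce
  then have "emeasure ?P N = 0"
    using e by (simp add: ennreal_eq_0_iff not_le)
  then show ?thesis
    by (intro AE_I[of _ _ N]) (auto simp: N_def not_less)
qed

text \<open>Kolmogorov's one-series theorem. Countably many radii 1/(j+1) are handled
  simultaneously, and a block between \<open>a\<close> and \<open>b\<close> is the difference of two
  blocks starting at the common index \<open>m\<close>, hence the radius below e/2.\<close>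

lemma AE_summable:
  assumes "summable v"
  shows "AE \<omega> in PiM UNIV M. summable (\<lambda>i. p i (\<omega> i))"
proof -
  have "AE \<omega> in PiM UNIV M. \<forall>j. \<exists>m. \<forall>k\<ge>m. \<bar>\<Sum>i\<in>{m..<k}. p i (\<omega> i)\<bar> < inverse (real (Suc j))"
    unfolding AE_all_countable using assms by (auto intro!: AE_tail_sums_small)
  then show ?thesis
  proof eventually_elim
    case (elim \<omega>)
    show ?case
      unfolding summable_Cauchy
    proof (intro allI impI)
      fix e :: real assume "0 < e"
      then obtain j where j: "inverse (real (Suc j)) < e / 2"
        using reals_Archimedean[of "e / 2"] by auto
      from elim obtain m where m: "\<bar>\<Sum>i\<in>{m..<k}. p i (\<omega> i)\<bar> < inverse (real (Suc j))" if "k \<ge> m" for k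
        by blast
      have "norm (\<Sum>i\<in>{a..<b}. p i (\<omega> i)) < e" if "a \<ge> m" for a b
      proof (cases "a \<le> b")
        case True
        have "(\<Sum>i\<in>{a..<b}. p i (\<omega> i)) = (\<Sum>i\<in>{m..<b}. p i (\<omega> i)) - (\<Sum>i\<in>{m..<a}. p i (\<omega> i))"
          using that True by (simp add: sum_diff_nat_ivl)
        then show ?thesis
          using m[of a] m[of b] j that True by simp
      qed (use \<open>0 < e\<close> in simp)
      then show "\<exists>N. \<forall>m\<ge>N. \<forall>n. norm (\<Sum>i\<in>{m..<n}. p i (\<omega> i)) < e"
        by blast
    qed
  qed
qed

text \<open>The squared distance between two partial sums is at most a tail of the variance series,
  so the closed form for finite sums passes to the almost sure limit.\<close>

lemma shifted_square_suminf:
  assumes "summable v"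
  shows "(\<integral>\<^sup>+\<omega>. ennreal ((x + (\<Sum>i. p i (\<omega> i)))\<^sup>2) \<partial>PiM UNIV M) = ennreal (x\<^sup>2 + suminf v)"
proof (rule nn_integral_square_limit[where X = "\<lambda>m \<omega>. x + (\<Sum>i<m. p i (\<omega> i))" and c = "\<lambda>m. x\<^sup>2 + sum v {..<m}"
      and \<tau> = "\<lambda>m. suminf v - sum v {..<m}"])
  show "AE \<omega> in PiM UNIV M. (\<lambda>m. x + (\<Sum>i<m. p i (\<omega> i))) \<longlonglongrightarrow> x + (\<Sum>i. p i (\<omega> i))"
    using AE_summable[OF assms] by eventually_elim (intro tendsto_intros summable_LIMSEQ)
  show "(\<integral>\<^sup>+\<omega>. ennreal (((x + (\<Sum>i<l. p i (\<omega> i))) - (x + (\<Sum>i<m. p i (\<omega> i))))\<^sup>2) \<partial>PiM UNIV M)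
      \<le> ennreal (suminf v - sum v {..<m})" if "m \<le> l" for m l
  proof -
    have "(x + (\<Sum>i<l. p i (\<omega> i))) - (x + (\<Sum>i<m. p i (\<omega> i))) = 0 + (\<Sum>i\<in>{m..<l}. p i (\<omega> i))" for \<omega>
      using that by (simp add: lessThan_atLeast0 sum_diff_nat_ivl)
    then have "(\<integral>\<^sup>+\<omega>. ennreal (((x + (\<Sum>i<l. p i (\<omega> i))) - (x + (\<Sum>i<m. p i (\<omega> i))))\<^sup>2) \<partial>PiM UNIV M)
        = ennreal (0\<^sup>2 + sum v {m..<l})"
      by (simp only: shifted_square_partial_sum finite_atLeastLessThan)
    also have "0\<^sup>2 + sum v {m..<l} = sum v {..<l} - sum v {..<m}"
      using that by (simp add: lessThan_atLeast0 sum_diff_nat_ivl)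
    also have "\<dots> \<le> suminf v - sum v {..<m}"
      using assms v_nonneg by (simp add: sum_le_suminf)
    finally show ?thesis
      by (simp add: ennreal_leI)
  qed
  show "(\<integral>\<^sup>+\<omega>. ennreal ((x + (\<Sum>i<m. p i (\<omega> i)))\<^sup>2) \<partial>PiM UNIV M) = ennreal (x\<^sup>2 + sum v {..<m})" for m
    by (simp add: shifted_square_partial_sum)
  show "(\<lambda>m. suminf v - sum v {..<m}) \<longlonglongrightarrow> 0"
    using summable_LIMSEQ[OF assms] by (auto intro!: tendsto_eq_intros)
  show "(\<lambda>m. x\<^sup>2 + sum v {..<m}) \<longlonglongrightarrow> x\<^sup>2 + suminf v"
    using summable_LIMSEQ[OF assms] by (intro tendsto_intros)
qed (use assms in \<open>auto simp: sum_le_suminf v_nonneg sum_nonneg\<close>)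

end

subsection \<open>Gaussian moments and the randomization\<close>

text \<open>The Hermite polynomials z and z^2 - 1 are centred and orthogonal with second moments 1
  and 2, so no cross terms survive. This one formula serves the linear summands, the squares of the
  data and the squares of the randomization.\<close>

lemma nn_integral_std_normal_quadratic:
  fixes x \<alpha> \<beta> :: real
  shows "(\<integral>\<^sup>+z. ennreal ((x + (\<alpha> * z + \<beta> * (z\<^sup>2 - 1)))\<^sup>2) \<partial>std_normal_distribution)
    = ennreal (x\<^sup>2 + (\<alpha>\<^sup>2 + 2 * \<beta>\<^sup>2))"
proof -
  let ?d = std_normal_density
  have "has_bochner_integral lborel (\<lambda>z. \<beta>\<^sup>2 * (?d z * z ^ (2 * 2)) + 2 * \<alpha> * \<beta> * (?d z * z ^ (2 * 1 + 1))
        + (\<alpha>\<^sup>2 + 2 * \<beta> * (x - \<beta>)) * (?d z * z ^ (2 * 1)) + 2 * \<alpha> * (x - \<beta>) * (?d z * z ^ (2 * 0 + 1))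
        + (x - \<beta>)\<^sup>2 * (?d z * z ^ (2 * 0)))
      (\<beta>\<^sup>2 * (fact (2 * 2) / (2 ^ 2 * fact 2)) + 2 * \<alpha> * \<beta> * 0
        + (\<alpha>\<^sup>2 + 2 * \<beta> * (x - \<beta>)) * (fact (2 * 1) / (2 ^ 1 * fact 1)) + 2 * \<alpha> * (x - \<beta>) * 0
        + (x - \<beta>)\<^sup>2 * (fact (2 * 0) / (2 ^ 0 * fact 0)))"
    by (intro has_bochner_integral_add has_bochner_integral_mult_right std_normal_moment_even std_normal_moment_odd)
  moreover have "(\<lambda>z. \<beta>\<^sup>2 * (?d z * z ^ (2 * 2)) + 2 * \<alpha> * \<beta> * (?d z * z ^ (2 * 1 + 1))
        + (\<alpha>\<^sup>2 + 2 * \<beta> * (x - \<beta>)) * (?d z * z ^ (2 * 1)) + 2 * \<alpha> * (x - \<beta>) * (?d z * z ^ (2 * 0 + 1))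
        + (x - \<beta>)\<^sup>2 * (?d z * z ^ (2 * 0))) = (\<lambda>z. ?d z * (x + (\<alpha> * z + \<beta> * (z\<^sup>2 - 1)))\<^sup>2)"
    by (rule ext) (simp, algebra)
  moreover have "\<beta>\<^sup>2 * (fact (2 * 2) / (2 ^ 2 * fact 2)) + 2 * \<alpha> * \<beta> * 0
        + (\<alpha>\<^sup>2 + 2 * \<beta> * (x - \<beta>)) * (fact (2 * 1) / (2 ^ 1 * fact 1)) + 2 * \<alpha> * (x - \<beta>) * 0
        + (x - \<beta>)\<^sup>2 * (fact (2 * 0) / (2 ^ 0 * fact 0)) = x\<^sup>2 + (\<alpha>\<^sup>2 + 2 * \<beta>\<^sup>2)"
    by (simp add: fact_numeral power2_eq_square algebra_simps)
  ultimately have hb: "has_bochner_integral lborel (\<lambda>z. ?d z * (x + (\<alpha> * z + \<beta> * (z\<^sup>2 - 1)))\<^sup>2)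
      (x\<^sup>2 + (\<alpha>\<^sup>2 + 2 * \<beta>\<^sup>2))"
    by (simp only:)
  have "(\<integral>\<^sup>+z. ennreal ((x + (\<alpha> * z + \<beta> * (z\<^sup>2 - 1)))\<^sup>2) \<partial>std_normal_distribution)
      = (\<integral>\<^sup>+z. ennreal (?d z * (x + (\<alpha> * z + \<beta> * (z\<^sup>2 - 1)))\<^sup>2) \<partial>lborel)"
    by (simp add: nn_integral_density ennreal_mult')
  also have "\<dots> = ennreal (x\<^sup>2 + (\<alpha>\<^sup>2 + 2 * \<beta>\<^sup>2))"
    using hb by (subst nn_integral_eq_integral) (auto simp: has_bochner_integral_iff)
  finally show ?thesis .
qed

lemma nn_integral_normal_standardize:
  assumes \<sigma>: "0 < \<sigma>" and [measurable]: "f \<in> borel_measurable borel"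
  shows "(\<integral>\<^sup>+y. f y \<partial>density lborel (\<lambda>y. ennreal (normal_density \<mu> \<sigma> y)))
    = (\<integral>\<^sup>+z. f (\<mu> + \<sigma> * z) \<partial>std_normal_distribution)"
proof -
  have "(\<integral>\<^sup>+y. f y \<partial>density lborel (\<lambda>y. ennreal (normal_density \<mu> \<sigma> y)))
      = (\<integral>\<^sup>+y. ennreal (normal_density \<mu> \<sigma> y) * f y \<partial>lborel)"
    by (simp add: nn_integral_density)
  also have "\<dots> = ennreal \<sigma> * (\<integral>\<^sup>+z. ennreal (normal_density \<mu> \<sigma> (\<mu> + \<sigma> * z)) * f (\<mu> + \<sigma> * z) \<partial>lborel)"
    using \<sigma> by (subst nn_integral_real_affine[where c = \<sigma> and t = \<mu>]) auto
  also have "\<dots> = (\<integral>\<^sup>+z. ennreal \<sigma> * (ennreal (normal_density \<mu> \<sigma> (\<mu> + \<sigma> * z)) * f (\<mu> + \<sigma> * z)) \<partial>lborel)"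
    by (rule nn_integral_cmult[symmetric]) measurable
  also have "\<dots> = (\<integral>\<^sup>+z. ennreal (std_normal_density z) * f (\<mu> + \<sigma> * z) \<partial>lborel)"
  proof (rule nn_integral_cong)
    fix z
    have "\<sigma> * normal_density \<mu> \<sigma> (\<mu> + \<sigma> * z) = std_normal_density z"
      using \<sigma> by (simp add: normal_density_def real_sqrt_mult field_simps power_mult_distrib)
    then show "ennreal \<sigma> * (ennreal (normal_density \<mu> \<sigma> (\<mu> + \<sigma> * z)) * f (\<mu> + \<sigma> * z))
        = ennreal (std_normal_density z) * f (\<mu> + \<sigma> * z)"
      using \<sigma> by (simp add: mult.assoc[symmetric] ennreal_mult'[symmetric])
  qed
  also have "\<dots> = (\<integral>\<^sup>+z. f (\<mu> + \<sigma> * z) \<partial>std_normal_distribution)"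
    by (simp add: nn_integral_density)
  finally show ?thesis .
qed

section \<open>The standard normal quantile function and inverse transform sampling\<close>

lemma strict_mono_Phi: "strict_mono Phi"
proof (rule strict_monoI)
  fix a b :: real
  assume ab: "a < b"
  interpret real_distribution std_normal_distribution
    by (rule real_dist_normal_dist)
  have "emeasure std_normal_distribution {a<..b} \<noteq> 0"
  proof
    assume "emeasure std_normal_distribution {a<..b} = 0"
    moreover have nonzero: "std_normal_density z \<noteq> 0" for z
      by (simp add: normal_density_def)
    ultimately have "AE z in lborel. z \<notin> {a<..b}"
      by (subst (asm) emeasure_density)
        (auto simp: nn_integral_0_iff_AE nonzero indicator_def not_le)
    then have "emeasure lborel {a<..b} = 0"
      by (subst (asm) AE_iff_measurable[of "{a<..b}"]) auto
    then show False
      using ab by simp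
  qed
  then have "0 < measure std_normal_distribution {a<..b}"
    by (simp add: emeasure_eq_measure zero_less_measure_iff)
  then show "Phi a < Phi b"
    unfolding Phi_def using cdf_diff_eq[OF ab] by simp
qed

lemma isCont_Phi: "isCont Phi z"
proof -
  interpret real_distribution std_normal_distribution
    by (rule real_dist_normal_dist)
  have "emeasure std_normal_distribution {z} = 0"
    by (subst emeasure_density) (auto intro!: nn_integral_null_set simp: null_sets_def)
  then show ?thesis
    unfolding Phi_def isCont_cdf by (simp add: measure_def)
qed

lemma range_Phi: "range Phi = {0<..<1}"
proof -
  interpret real_distribution std_normal_distribution
    by (rule real_dist_normal_dist)
  have "Phi z \<in> {0<..<1}" for z
  proof -
    have "0 \<le> Phi (z - 1)" "Phi (z - 1) < Phi z" "Phi z < Phi (z + 1)" "Phi (z + 1) \<le> 1"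
      using strict_mono_Phi by (auto simp: Phi_def cdf_nonneg cdf_bounded_prob strict_mono_def)
    then show ?thesis by simp
  qed
  moreover have "u \<in> range Phi" if "0 < u" "u < 1" for u
  proof -
    obtain a where a: "Phi a < u"
    proof -
      have "eventually (\<lambda>a. Phi a < u) at_bot"
        using order_tendstoD(2)[OF cdf_lim_at_bot \<open>0 < u\<close>] by (simp add: Phi_def)
      then show ?thesis using that eventually_happens' trivial_limit_at_bot_linorder by blast
    qed
    obtain b where b: "u < Phi b"
    proof -
      have "eventually (\<lambda>b. u < Phi b) at_top"
        using order_tendstoD(1)[OF cdf_lim_at_top_prob \<open>u < 1\<close>] by (simp add: Phi_def)
      then show ?thesis using that eventually_happens' trivial_limit_at_top_linorder by blast
    qed
    have "a \<le> b"
      using a b strict_mono_less_eq[OF strict_mono_Phi] by (metis less_trans less_imp_le)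
    then obtain z where "Phi z = u"
      using IVT[of Phi a u b] a b isCont_Phi by (metis less_imp_le)
    then show ?thesis by blast
  qed
  ultimately show ?thesis by auto
qed

lemma Phi_inv_le_iff:
  assumes "0 < u" "u < 1"
  shows "Phi_inv u \<le> z \<longleftrightarrow> u \<le> Phi z"
proof -
  from assms obtain w where w: "u = Phi w"
    using range_Phi by (metis greaterThanLessThan_iff imageE)
  have "Phi_inv u = w"
    unfolding w Phi_inv_def using strict_mono_imp_inj_on[OF strict_mono_Phi] by (simp add: the_inv_f_f)
  then show ?thesis
    using w strict_mono_less_eq[OF strict_mono_Phi] by simp
qed

text \<open>Outside the open unit interval the description operator is applied to an unsatisfiable
  predicate, so its value is the same for all such \<open>u\<close>. This makes
  \<open>Phi_inv\<close> measurable as a total function: each sublevel set contains either the whole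
  complement of the interval or none of it.\<close>

lemma Phi_inv_outside:
  assumes "u \<notin> {0<..<1}"
  shows "Phi_inv u = (THE z. False)"
proof -
  have "Phi z \<noteq> u" for z
    using assms range_Phi by blast
  then show ?thesis
    unfolding Phi_inv_def the_inv_into_def by simp
qed

lemma borel_measurable_Phi_inv [measurable]: "Phi_inv \<in> borel_measurable borel"
proof (rule borel_measurableI_le)
  fix z
  have "{u. Phi_inv u \<le> z} = ({0<..<1} \<inter> {..Phi z}) \<union> ({..0} \<union> {1..}) \<inter> (if (THE z. False) \<le> z then UNIV else {})"
  proof (rule set_eqI)
    fix u
    show "u \<in> {u. Phi_inv u \<le> z} \<longleftrightarrow>
        u \<in> ({0<..<1} \<inter> {..Phi z}) \<union> ({..0} \<union> {1..}) \<inter> (if (THE z. False) \<le> z then UNIV else {})"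
      using Phi_inv_le_iff[of u z] Phi_inv_outside[of u] by (cases "u \<in> {0<..<1}") auto
  qed
  then show "{u \<in> space borel. Phi_inv u \<le> z} \<in> sets borel"
    by simp
qed

text \<open>Inverse transform sampling, checked on distribution functions. The endpoints 0 and 1,
  where \<open>Phi_inv\<close> takes its default value, are null points.\<close>

lemma distr_uniform_Phi_inv:
  "distr (uniform_measure lborel {0..1}) borel Phi_inv = std_normal_distribution"
proof (rule cdf_unique)
  let ?U = "uniform_measure lborel {0..1::real}"
  interpret N: real_distribution std_normal_distribution
    by (rule real_dist_normal_dist)
  interpret U: prob_space ?U
    by (rule prob_space_uniform_measure) auto
  show "real_distribution (distr ?U borel Phi_inv)"
    by (rule U.real_distribution_distr) simp
  show "real_distribution std_normal_distribution"
    by (rule real_dist_normal_dist)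
  show "cdf (distr ?U borel Phi_inv) = cdf std_normal_distribution"
  proof
    fix z
    have "Phi z \<in> {0<..<1}"
      using range_Phi by blast
    have "emeasure (distr ?U borel Phi_inv) {..z} = emeasure ?U {u. Phi_inv u \<le> z}"
      by (subst emeasure_distr) (auto simp: vimage_def)
    also have "\<dots> = emeasure lborel ({0..1} \<inter> {u. Phi_inv u \<le> z})"
      by (subst emeasure_uniform_measure) (auto simp: divide_ennreal_def)
    also have "\<dots> = emeasure lborel {0<..Phi z}"
    proof (rule emeasure_eq_AE)
      show "AE u in lborel. u \<in> {0..1} \<inter> {u. Phi_inv u \<le> z} \<longleftrightarrow> u \<in> {0<..Phi z}"
        using AE_lborel_singleton[of 0] AE_lborel_singleton[of 1]
      proof eventually_elim
        case (elim u)
        then show ?case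
          using Phi_inv_le_iff[of u z] \<open>Phi z \<in> {0<..<1}\<close> by auto
      qed
    qed auto
    also have "\<dots> = ennreal (Phi z)"
      using \<open>Phi z \<in> {0<..<1}\<close> by simp
    finally show "cdf (distr ?U borel Phi_inv) z = cdf std_normal_distribution z"
      using \<open>Phi z \<in> {0<..<1}\<close> by (simp add: cdf_def2[of "distr _ _ _"] measure_def Phi_def)
  qed
qed

lemma Qhat2_estimator: "Qhat2 n \<theta>h k \<in> estimators"
  unfolding Qhat2_def Qhat1_def Y1_def Y2_def estimators_def case_prod_beta
  by measurable

lemma Qhat2_0: "Qhat2 n \<theta>h 0 = Qhat1 \<theta>h"
  by (simp add: Qhat2_def)

subsection \<open>Mean squared errors\<close>

lemma l2_summable_mult:
  assumes "a \<in> l2" "b \<in> l2"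
  shows "summable (\<lambda>i. a i * b i)"
proof (rule summable_comparison_test')
  show "summable (\<lambda>i. (a i)\<^sup>2 + (b i)\<^sup>2)"
    using assms by (auto simp: l2_def intro: summable_add)
  fix i
  have "0 \<le> \<bar>a i\<bar> * \<bar>b i\<bar>" by simp
  then show "norm (a i * b i) \<le> (a i)\<^sup>2 + (b i)\<^sup>2"
    using sum_squares_bound[of "\<bar>a i\<bar>" "\<bar>b i\<bar>"]
    unfolding real_norm_def abs_mult power2_abs by linarith
qed

lemma l2_diff:
  assumes "a \<in> l2" "b \<in> l2"
  shows "(\<lambda>i. a i - b i) \<in> l2"
  using assms l2_summable_mult[OF assms] unfolding l2_def
  by (auto simp: power2_diff mult.assoc intro!: summable_diff summable_add summable_mult)

lemma l2_shift: "a \<in> l2 \<Longrightarrow> (\<lambda>i. a (i + k)) \<in> l2"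
  unfolding l2_def using summable_ignore_initial_segment[of "\<lambda>i. (a i)\<^sup>2" k] by simp

lemma sqnorm_nonneg: "a \<in> l2 \<Longrightarrow> 0 \<le> sqnorm a"
  unfolding l2_def sqnorm_def by (simp add: suminf_nonneg)

lemma sqnorm_split: "a \<in> l2 \<Longrightarrow> sqnorm a = (\<Sum>i<k. (a i)\<^sup>2) + sqnorm (\<lambda>i. a (i + k))"
  unfolding l2_def sqnorm_def using suminf_split_initial_segment[of "\<lambda>i. (a i)\<^sup>2" k] by simp

lemma prob_space_normal:
  "0 < n \<Longrightarrow> prob_space (density lborel (\<lambda>x. ennreal (normal_density \<mu> (1 / sqrt (real n)) x)))"
  by (rule prob_space_normal_density) simp

lemma prob_space_data_law: "0 < n \<Longrightarrow> prob_space (data_law n \<theta>)"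
  unfolding data_law_def by (intro prob_space_PiM prob_space_normal)

lemma prob_space_uniform: "prob_space (uniform_measure lborel {0..1::real})"
  by (rule prob_space_uniform_measure) auto

lemma prob_space_aux_law: "prob_space aux_law"
  unfolding aux_law_def by (intro prob_space_PiM prob_space_uniform)

lemma sets_data_law [measurable_cong]: "sets (data_law n \<theta>) = sets (\<Pi>\<^sub>M i\<in>UNIV. borel)"
  unfolding data_law_def by (intro sets_PiM_cong) auto

lemma sets_aux_law [measurable_cong]: "sets aux_law = sets (\<Pi>\<^sub>M i\<in>UNIV. borel)"
  unfolding aux_law_def by (intro sets_PiM_cong) auto

lemma estimators_measurable:
  assumes "T \<in> estimators"
  shows "T \<in> borel_measurable (data_law n \<theta> \<Otimes>\<^sub>M aux_law)"
  using assms unfolding estimators_def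
  by (subst measurable_cong_sets[OF sets_pair_measure_cong[OF sets_data_law sets_aux_law] refl])

lemma nn_integral_law_snd:
  assumes "0 < n" and f: "f \<in> borel_measurable (data_law n \<theta> \<Otimes>\<^sub>M aux_law)"
  shows "(\<integral>\<^sup>+\<omega>. f \<omega> \<partial>law n \<theta>) = (\<integral>\<^sup>+u. (\<integral>\<^sup>+y. f (y, u) \<partial>data_law n \<theta>) \<partial>aux_law)"
proof -
  interpret D: prob_space "data_law n \<theta>" using assms by (rule_tac prob_space_data_law)
  interpret U: prob_space aux_law by (rule prob_space_aux_law)
  interpret pair_sigma_finite "data_law n \<theta>" aux_law ..
  show ?thesis
    unfolding law_def by (rule nn_integral_snd[OF f, symmetric])
qed

lemma product_prob_space_nat: "(\<And>i. prob_space (M i)) \<Longrightarrow> product_prob_space M"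
  by (simp add: product_prob_space_def product_prob_space_axioms_def product_sigma_finite_def
      prob_space_imp_sigma_finite)

text \<open>Up to index \<open>k\<close> the correction cancels the terms linear in
  \<open>\<theta>h\<close> and leaves the centred square of the observation; from \<open>k\<close>
  on the centred linear term of \<open>Qhat1\<close> remains. Substituting y = \<theta> + z / sqrt n
  turns a centred square into (2 \<theta> / sqrt n) z + (z^2 - 1) / n, from which the variances can
  be read off.\<close>

lemma centered_square_sequence_data:
  assumes n: "0 < n"
  shows "centered_square_sequence (\<lambda>i. density lborel (\<lambda>x. ennreal (normal_density (\<theta> i) (1 / sqrt (real n)) x)))
    (\<lambda>i y. if i < k then y\<^sup>2 - (\<theta> i)\<^sup>2 - 1 / real n else 2 * \<theta>h i * (y - \<theta> i))
    (\<lambda>i. if i < k then 4 / real n * (\<theta> i)\<^sup>2 + 2 / (real n)\<^sup>2 else 4 / real n * (\<theta>h i)\<^sup>2)"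
proof (intro centered_square_sequence.intro product_prob_space_nat prob_space_normal n
    centered_square_sequence_axioms.intro)
  fix i and x :: real
  let ?p = "\<lambda>y. if i < k then y\<^sup>2 - (\<theta> i)\<^sup>2 - 1 / real n else 2 * \<theta>h i * (y - \<theta> i)"
  define s where "s = sqrt (real n)"
  have s: "s > 0" "real n = s\<^sup>2" using n by (auto simp: s_def)
  have "(\<integral>\<^sup>+y. ennreal ((x + ?p y)\<^sup>2) \<partial>density lborel (\<lambda>x. ennreal (normal_density (\<theta> i) (1 / sqrt (real n)) x)))
      = (\<integral>\<^sup>+z. ennreal ((x + ?p (\<theta> i + 1 / sqrt (real n) * z))\<^sup>2) \<partial>std_normal_distribution)"
    using n by (intro nn_integral_normal_standardize) auto
  also have "(\<lambda>z. ?p (\<theta> i + 1 / sqrt (real n) * z))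
      = (\<lambda>z. (if i < k then 2 * \<theta> i / s else 2 * \<theta>h i / s) * z + (if i < k then 1 / real n else 0) * (z\<^sup>2 - 1))"
    unfolding s_def[symmetric] s(2) using s(1) by (auto simp: field_simps power2_eq_square)
  finally show "(\<integral>\<^sup>+y. ennreal ((x + ?p y)\<^sup>2) \<partial>density lborel (\<lambda>x. ennreal (normal_density (\<theta> i) (1 / sqrt (real n)) x)))
      = ennreal (x\<^sup>2 + (if i < k then 4 / real n * (\<theta> i)\<^sup>2 + 2 / (real n)\<^sup>2 else 4 / real n * (\<theta>h i)\<^sup>2))"
    unfolding nn_integral_std_normal_quadratic using s by (auto simp: power_divide power_mult_distrib)
qed auto

text \<open>The square of an observation exceeds the squared coordinate by 1/n on average, and the
  square of \<open>Phi_inv U\<close> divided by n also has mean 1/n. Hence the product of the two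
  split observations is unbiased, and both squares can be centred separately.\<close>

lemma centered_square_sequence_aux:
  "centered_square_sequence (\<lambda>_. uniform_measure lborel {0..1})
    (\<lambda>_ u. - (1 / real n) * ((Phi_inv u)\<^sup>2 - 1)) (\<lambda>_. 2 / (real n)\<^sup>2)"
proof (intro centered_square_sequence.intro product_prob_space_nat prob_space_uniform
    centered_square_sequence_axioms.intro)
  fix x :: real
  have "(\<integral>\<^sup>+u. ennreal ((x + - (1 / real n) * ((Phi_inv u)\<^sup>2 - 1))\<^sup>2) \<partial>uniform_measure lborel {0..1})
      = (\<integral>\<^sup>+z. ennreal ((x + (0 * z + - (1 / real n) * (z\<^sup>2 - 1)))\<^sup>2)
          \<partial>distr (uniform_measure lborel {0..1}) borel Phi_inv)"
    by (subst nn_integral_distr) auto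
  then show "(\<integral>\<^sup>+u. ennreal ((x + - (1 / real n) * ((Phi_inv u)\<^sup>2 - 1))\<^sup>2) \<partial>uniform_measure lborel {0..1})
      = ennreal (x\<^sup>2 + 2 / (real n)\<^sup>2)"
    unfolding distr_uniform_Phi_inv nn_integral_std_normal_quadratic by (simp add: power_divide)
qed auto

text \<open>The randomization enters only through \<open>Y1 * Y2 = Y\<^sup>2 - (Phi_inv U)\<^sup>2 / n\<close>.\<close>

lemma Qhat2_error:
  fixes y u :: "nat \<Rightarrow> real" and k :: nat
  assumes n: "0 < n" and l2: "\<theta> \<in> l2" "\<theta>h \<in> l2"
  defines "p \<equiv> \<lambda>i y. if i < k then y\<^sup>2 - (\<theta> i)\<^sup>2 - 1 / real n else 2 * \<theta>h i * (y - \<theta> i)"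
  assumes "summable (\<lambda>i. p i (y i))"
  shows "Qhat2 n \<theta>h k (y, u) - Q \<theta>
    = (- sqnorm (\<lambda>i. \<theta>h (i + k) - \<theta> (i + k)) + (\<Sum>i<k. - (1 / real n) * ((Phi_inv (u i))\<^sup>2 - 1)))
      + (\<Sum>i. p i (y i))"
proof -
  let ?T = "sqnorm (\<lambda>i. \<theta>h (i + k) - \<theta> (i + k))"
  \<comment> \<open>\<open>?g\<close> is the difference, on the first \<open>k\<close> coordinates,
    between the linear term and the centred square that replaces it; adding the correction of
    \<open>Qhat2\<close> leaves only the randomization.\<close>
  let ?g = "\<lambda>i. if i < k then 2 * (y i * \<theta>h i) - (\<theta>h i)\<^sup>2 - (y i)\<^sup>2 + 1 / real n else 0"
  have "(\<lambda>i. \<theta>h i - \<theta> i) \<in> l2"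
    using l2 by (intro l2_diff)
  then have "summable (\<lambda>i. (\<theta>h (i + k) - \<theta> (i + k))\<^sup>2)"
    using l2_shift[of "\<lambda>i. \<theta>h i - \<theta> i" k] by (simp add: l2_def)
  then have "(\<lambda>i. if i + k < k then 0 else (\<theta>h (i + k) - \<theta> (i + k))\<^sup>2) sums ?T"
    unfolding sqnorm_def by (simp add: summable_sums)
  then have T: "(\<lambda>i. if i < k then 0 else (\<theta>h i - \<theta> i)\<^sup>2) sums ?T"
    by (subst (asm) sums_iff_shift) simp
  have g: "?g sums (\<Sum>i<k. ?g i)"
    by (rule sums_finite) auto
  \<comment> \<open>This is where convergence of the series in \<open>Qhat1\<close> comes from:
    along the given path it is a combination of convergent series, whether or not it converges
    absolutely.\<close>
  have "(\<lambda>i. p i (y i) - (if i < k then 0 else (\<theta>h i - \<theta> i)\<^sup>2) + ?g i + (\<theta>h i)\<^sup>2 + (\<theta> i)\<^sup>2)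
      sums ((\<Sum>i. p i (y i)) - ?T + (\<Sum>i<k. ?g i) + sqnorm \<theta>h + sqnorm \<theta>)"
    using l2 unfolding l2_def sqnorm_def
    by (intro sums_add sums_diff summable_sums assms(5) T[unfolded sqnorm_def] g) auto
  also have "(\<lambda>i. p i (y i) - (if i < k then 0 else (\<theta>h i - \<theta> i)\<^sup>2) + ?g i + (\<theta>h i)\<^sup>2 + (\<theta> i)\<^sup>2)
      = (\<lambda>i. 2 * (y i * \<theta>h i))"
    unfolding p_def by (auto simp: fun_eq_iff power2_eq_square algebra_simps)
  finally have "2 * (\<Sum>i. y i * \<theta>h i) = (\<Sum>i. p i (y i)) - ?T + (\<Sum>i<k. ?g i) + sqnorm \<theta>h + sqnorm \<theta>"
    using sums_mult[of _ _ "1 / 2"] by (fastforce simp: sums_iff)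
  then have "Qhat1 \<theta>h (y, u) - Q \<theta> = (\<Sum>i. p i (y i)) - ?T + (\<Sum>i<k. ?g i)"
    by (simp add: Qhat1_def Q_def)
  moreover have "(\<Sum>i<k. ?g i) + (\<Sum>i<k. Y1 n (y, u) i * Y2 n (y, u) i - 2 * fst (y, u) i * \<theta>h i + (\<theta>h i)\<^sup>2)
      = (\<Sum>i<k. - (1 / real n) * ((Phi_inv (u i))\<^sup>2 - 1))"
    unfolding sum.distrib[symmetric]
    by (intro sum.cong) (auto simp: Y1_def Y2_def algebra_simps power2_eq_square)
  ultimately show ?thesis
    unfolding Qhat2_def by simp
qed

text \<open>With \<open>u\<close> frozen, the bias and the randomization together form a constant
  shift of the data series, so its variance is simply added; the same argument over \<open>u\<close>
  starts from the shift \<open>- T\<close>. The last term collects 2 k / n^2 from the squared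
  observations and as much from the randomization.\<close>

lemma mse_Qhat2:
  assumes n: "0 < n" and l2: "\<theta> \<in> l2" "\<theta>h \<in> l2"
  shows "mse n (Qhat2 n \<theta>h k) \<theta> = ennreal ((sqnorm (\<lambda>i. \<theta>h (i + k) - \<theta> (i + k)))\<^sup>2
    + 4 / real n * ((\<Sum>i<k. (\<theta> i)\<^sup>2) + sqnorm (\<lambda>i. \<theta>h (i + k))) + 4 * real k / (real n)\<^sup>2)"
proof -
  define p where "p i y = (if i < k then y\<^sup>2 - (\<theta> i)\<^sup>2 - 1 / real n else 2 * \<theta>h i * (y - \<theta> i))" for i y
  define v where "v i = (if i < k then 4 / real n * (\<theta> i)\<^sup>2 + 2 / (real n)\<^sup>2 else 4 / real n * (\<theta>h i)\<^sup>2)" for i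
  define T where "T = sqnorm (\<lambda>i. \<theta>h (i + k) - \<theta> (i + k))"
  interpret D: centered_square_sequence
    "\<lambda>i. density lborel (\<lambda>x. ennreal (normal_density (\<theta> i) (1 / sqrt (real n)) x))" p v
    unfolding p_def[abs_def] v_def[abs_def] by (rule centered_square_sequence_data[OF n])
  interpret U: centered_square_sequence "\<lambda>_. uniform_measure lborel {0..1}"
    "\<lambda>_ u. - (1 / real n) * ((Phi_inv u)\<^sup>2 - 1)" "\<lambda>_. 2 / (real n)\<^sup>2"
    by (rule centered_square_sequence_aux)
  interpret UP: prob_space aux_law by (rule prob_space_aux_law)
  let ?q = "\<lambda>u. \<Sum>i<k. - (1 / real n) * ((Phi_inv (u i))\<^sup>2 - 1)"
  have tail: "summable (\<lambda>i. 4 / real n * (\<theta>h (i + k))\<^sup>2)"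
    using l2_shift[OF l2(2), of k] by (intro summable_mult) (simp add: l2_def)
  then have v_shift: "summable (\<lambda>i. v (i + k))"
    unfolding v_def by simp
  then have v: "summable v"
    by (subst (asm) summable_iff_shift)
  have "suminf v = (\<Sum>i. v (i + k)) + sum v {..<k}"
    by (rule suminf_split_initial_segment[OF v])
  also have "(\<Sum>i. v (i + k)) = 4 / real n * sqnorm (\<lambda>i. \<theta>h (i + k))"
    using l2_shift[OF l2(2), of k] unfolding v_def sqnorm_def l2_def
    by (subst suminf_mult[symmetric]) simp_all
  also have "sum v {..<k} = (\<Sum>i<k. 4 / real n * (\<theta> i)\<^sup>2 + 2 / (real n)\<^sup>2)"
    unfolding v_def by (intro sum.cong) auto
  also have "\<dots> = 4 / real n * (\<Sum>i<k. (\<theta> i)\<^sup>2) + 2 * real k / (real n)\<^sup>2"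
    by (simp add: sum.distrib sum_distrib_left)
  finally have suminf_v: "suminf v = 4 / real n * ((\<Sum>i<k. (\<theta> i)\<^sup>2) + sqnorm (\<lambda>i. \<theta>h (i + k)))
      + 2 * real k / (real n)\<^sup>2"
    by (simp add: algebra_simps)
  have v0: "0 \<le> suminf v"
    by (intro suminf_nonneg v D.v_nonneg)
  have meas [measurable]: "(\<lambda>\<omega>. ennreal ((Qhat2 n \<theta>h k \<omega> - Q \<theta>)\<^sup>2)) \<in> borel_measurable (data_law n \<theta> \<Otimes>\<^sub>M aux_law)"
    using estimators_measurable[OF Qhat2_estimator] by measurable
  have "mse n (Qhat2 n \<theta>h k) \<theta>
      = (\<integral>\<^sup>+u. (\<integral>\<^sup>+y. ennreal ((Qhat2 n \<theta>h k (y, u) - Q \<theta>)\<^sup>2) \<partial>data_law n \<theta>) \<partial>aux_law)"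
    unfolding mse_def by (rule nn_integral_law_snd[OF n meas])
  also have "\<dots> = (\<integral>\<^sup>+u. (\<integral>\<^sup>+y. ennreal (((- T + ?q u) + (\<Sum>i. p i (y i)))\<^sup>2) \<partial>data_law n \<theta>) \<partial>aux_law)"
  proof (rule nn_integral_cong, rule nn_integral_cong_AE)
    fix u
    show "AE y in data_law n \<theta>. ennreal ((Qhat2 n \<theta>h k (y, u) - Q \<theta>)\<^sup>2)
        = ennreal (((- T + ?q u) + (\<Sum>i. p i (y i)))\<^sup>2)"
      using D.AE_summable[OF v] unfolding data_law_def
    proof eventually_elim
      case (elim y)
      then show ?case
        using Qhat2_error[OF n l2, of k y u] unfolding p_def T_def by simp
    qed
  qed
  also have "\<dots> = (\<integral>\<^sup>+u. ennreal ((- T + ?q u)\<^sup>2) + ennreal (suminf v) \<partial>aux_law)"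
    unfolding data_law_def D.shifted_square_suminf[OF v] using v0 by simp
  also have "\<dots> = (\<integral>\<^sup>+u. ennreal ((- T + ?q u)\<^sup>2) \<partial>aux_law) + ennreal (suminf v)"
    by (subst nn_integral_add) (auto simp: UP.emeasure_space_1)
  also have "(\<integral>\<^sup>+u. ennreal ((- T + ?q u)\<^sup>2) \<partial>aux_law) = ennreal (T\<^sup>2 + 2 * real k / (real n)\<^sup>2)"
    unfolding aux_law_def by (subst U.shifted_square_partial_sum) simp_all
  also have "\<dots> + ennreal (suminf v) = ennreal (T\<^sup>2 + 2 * real k / (real n)\<^sup>2 + suminf v)"
    using v0 by (simp add: ennreal_plus[symmetric] del: ennreal_plus)
  finally show ?thesis
    unfolding suminf_v T_def by (simp add: algebra_simps)
qed

subsection \<open>Le Cam lower bounds for Gaussian shifts\<close>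

lemma (in product_prob_space) nn_integral_PiM_prod:
  assumes "finite J" "J \<subseteq> I" and [measurable]: "\<And>i. i \<in> J \<Longrightarrow> f i \<in> borel_measurable (M i)"
  shows "(\<integral>\<^sup>+\<omega>. (\<Prod>i\<in>J. f i (\<omega> i)) \<partial>PiM I M) = (\<Prod>i\<in>J. integral\<^sup>N (M i) (f i))"
proof -
  have "(\<integral>\<^sup>+\<omega>. (\<Prod>i\<in>J. f i (\<omega> i)) \<partial>PiM I M)
      = (\<integral>\<^sup>+\<omega>. (\<Prod>i\<in>J. f i (restrict \<omega> J i)) \<partial>PiM I M)"
    by (intro nn_integral_cong prod.cong) auto
  also have "\<dots> = (\<integral>\<^sup>+\<omega>. (\<Prod>i\<in>J. f i (\<omega> i)) \<partial>distr (PiM I M) (PiM J M) (\<lambda>\<omega>. restrict \<omega> J))"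
    using assms by (subst nn_integral_distr) (auto intro!: measurable_restrict_subset borel_measurable_prod_ennreal)
  also have "\<dots> = (\<Prod>i\<in>J. integral\<^sup>N (M i) (f i))"
    using assms by (simp add: distr_PiM_restrict_finite product_nn_integral_prod)
  finally show ?thesis .
qed

text \<open>Two finite measures on the product agree if they agree on cylinders. Only the factors in
  \<open>J\<close> change, so on a cylinder over \<open>K\<close> everything reduces to a finite
  product over \<open>J \<union> K\<close>.\<close>

lemma (in product_prob_space) PiM_density:
  assumes J: "finite J" "J \<subseteq> I"
    and [measurable]: "\<And>i. g i \<in> borel_measurable (M i)"
    and one: "\<And>i. integral\<^sup>N (M i) (g i) = 1"
    and outside: "\<And>i x. i \<notin> J \<Longrightarrow> g i x = 1"
  shows "PiM I (\<lambda>i. density (M i) (g i)) = density (PiM I M) (\<lambda>\<omega>. \<Prod>i\<in>J. g i (\<omega> i))"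
proof (rule measure_eqI_PiM_infinite[where I = I and M = M])
  have prob: "prob_space (density (M i) (g i))" for i
    by (rule prob_spaceI) (simp add: emeasure_density one cong: nn_integral_cong)
  show "sets (PiM I (\<lambda>i. density (M i) (g i))) = sets (PiM I M)"
    by (intro sets_PiM_cong) auto
  show "sets (density (PiM I M) (\<lambda>\<omega>. \<Prod>i\<in>J. g i (\<omega> i))) = sets (PiM I M)"
    by simp
  show "finite_measure (PiM I (\<lambda>i. density (M i) (g i)))"
    by (intro prob_space.finite_measure prob_space_PiM prob)
  fix A K
  assume K: "finite K" "K \<subseteq> I" and A: "\<And>i. i \<in> K \<Longrightarrow> A i \<in> sets (M i)"
  have [measurable]: "(\<lambda>\<omega>. \<Prod>i\<in>J. g i (\<omega> i)) \<in> borel_measurable (PiM I M)"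
    using J by (intro borel_measurable_prod_ennreal) auto
  \<comment> \<open>The factors \<open>h i\<close> merge density and cylinder condition: outside
    \<open>K\<close> they integrate to 1, and outside \<open>J\<close> the density is 1, so both
    sides extend to the common index set.\<close>
  define h where "h i x = (if i \<in> K then g i x * indicator (A i) x else g i x)" for i x
  have [measurable]: "h i \<in> borel_measurable (M i)" for i
    unfolding h_def[abs_def] using A by (cases "i \<in> K") auto
  have "emeasure (PiM I (\<lambda>i. density (M i) (g i))) (prod_emb I M K (Pi\<^sub>E K A))
      = (\<Prod>i\<in>K. emeasure (density (M i) (g i)) (A i))"
    using Infinite_Product_Measure.emeasure_PiM_emb[of I "\<lambda>i. density (M i) (g i)" K A] prob K A by (simp add: prod_emb_def)
  also have "\<dots> = (\<Prod>i\<in>K. integral\<^sup>N (M i) (h i))"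
    using A by (intro prod.cong) (auto simp: emeasure_density h_def cong: nn_integral_cong)
  also have "\<dots> = (\<Prod>i\<in>J \<union> K. integral\<^sup>N (M i) (h i))"
    using J K by (intro prod.mono_neutral_left) (auto simp: h_def one cong: nn_integral_cong)
  also have "\<dots> = (\<integral>\<^sup>+\<omega>. (\<Prod>i\<in>J \<union> K. h i (\<omega> i)) \<partial>PiM I M)"
    using J K by (intro nn_integral_PiM_prod[symmetric]) auto
  also have "\<dots> = (\<integral>\<^sup>+\<omega>. (\<Prod>i\<in>J. g i (\<omega> i)) * indicator (prod_emb I M K (Pi\<^sub>E K A)) \<omega> \<partial>PiM I M)"
  proof (rule nn_integral_cong)
    fix \<omega> assume \<omega>: "\<omega> \<in> space (PiM I M)"
    have "(\<Prod>i\<in>J \<union> K. h i (\<omega> i))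
        = (\<Prod>i\<in>J \<union> K. g i (\<omega> i)) * (\<Prod>i\<in>J \<union> K. if i \<in> K then indicator (A i) (\<omega> i) else 1)"
      unfolding prod.distrib[symmetric] by (intro prod.cong) (auto simp: h_def)
    also have "(\<Prod>i\<in>J \<union> K. g i (\<omega> i)) = (\<Prod>i\<in>J. g i (\<omega> i))"
      using J K by (intro prod.mono_neutral_right) (auto simp: outside)
    also have "(\<Prod>i\<in>J \<union> K. if i \<in> K then indicator (A i) (\<omega> i) else (1::ennreal)) = (\<Prod>i\<in>K. indicator (A i) (\<omega> i))"
      using J K by (intro prod.mono_neutral_cong_right) auto
    also have "\<dots> = indicator (prod_emb I M K (Pi\<^sub>E K A)) \<omega>"
    proof (cases "\<forall>i\<in>K. \<omega> i \<in> A i")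
      case True
      then show ?thesis
        using \<omega> by (auto simp: prod_emb_def space_PiM indicator_def)
    next
      case False
      then have "(\<Prod>i\<in>K. indicator (A i) (\<omega> i)) = (0 :: ennreal)"
        using K by (intro prod_zero) (auto simp: indicator_def)
      then show ?thesis
        using False by (auto simp: prod_emb_def indicator_def PiE_iff)
    qed
    finally show "(\<Prod>i\<in>J \<union> K. h i (\<omega> i)) = (\<Prod>i\<in>J. g i (\<omega> i)) * indicator (prod_emb I M K (Pi\<^sub>E K A)) \<omega>" .
  qed
  also have "\<dots> = emeasure (density (PiM I M) (\<lambda>\<omega>. \<Prod>i\<in>J. g i (\<omega> i))) (prod_emb I M K (Pi\<^sub>E K A))"
    using K A by (subst emeasure_density) (auto intro!: sets_PiM_I)
  finally show "emeasure (PiM I (\<lambda>i. density (M i) (g i))) (prod_emb I M K (Pi\<^sub>E K A))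
      = emeasure (density (PiM I M) (\<lambda>\<omega>. \<Prod>i\<in>J. g i (\<omega> i))) (prod_emb I M K (Pi\<^sub>E K A))" .
qed

lemma normal_density_shift:
  assumes "0 < n"
  shows "normal_density \<mu> (1 / sqrt n) y * exp (n * ((y - \<mu>) * d - d\<^sup>2 / 2))
    = normal_density (\<mu> + d) (1 / sqrt n) y"
proof -
  have "- (y - \<mu>)\<^sup>2 * n / 2 + n * ((y - \<mu>) * d - d\<^sup>2 / 2) = - (y - (\<mu> + d))\<^sup>2 * n / 2"
    by (simp add: power2_eq_square field_simps)
  then show ?thesis
    using assms by (simp add: normal_density_def power_divide exp_add[symmetric])
qed

text \<open>The Radon-Nikodym derivative of the law shifted by \<open>\<delta>\<close> when
  \<open>\<delta>\<close> vanishes outside the finite set \<open>J\<close>. Keeping \<open>J\<close>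
  explicit makes the exponent a finite sum, so convergence never has to be discussed.\<close>

definition likelihood_ratio :: "nat \<Rightarrow> (nat \<Rightarrow> real) \<Rightarrow> nat set \<Rightarrow> (nat \<Rightarrow> real) \<Rightarrow> (nat \<Rightarrow> real) \<Rightarrow> real" where
  "likelihood_ratio n \<theta> J \<delta> y = exp (\<Sum>i\<in>J. real n * ((y i - \<theta> i) * \<delta> i - (\<delta> i)\<^sup>2 / 2))"

lemma borel_measurable_likelihood_ratio [measurable]:
  "likelihood_ratio n \<theta> J \<delta> \<in> borel_measurable (\<Pi>\<^sub>M i\<in>UNIV. borel)"
  unfolding likelihood_ratio_def[abs_def] by measurable

lemma data_law_shift:
  assumes n: "0 < n" and J: "finite J" "\<And>i. i \<notin> J \<Longrightarrow> \<delta> i = 0"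
  shows "data_law n (\<lambda>i. \<theta> i + \<delta> i) = density (data_law n \<theta>) (\<lambda>y. ennreal (likelihood_ratio n \<theta> J \<delta> y))"
proof -
  let ?N = "\<lambda>\<mu>. density lborel (\<lambda>x. ennreal (normal_density \<mu> (1 / sqrt (real n)) x))"
  let ?g = "\<lambda>i x. ennreal (exp (real n * ((x - \<theta> i) * \<delta> i - (\<delta> i)\<^sup>2 / 2)))"
  interpret product_prob_space "\<lambda>i. ?N (\<theta> i)" UNIV
    by (intro product_prob_space_nat prob_space_normal n)
  have dens: "density (?N (\<theta> i)) (?g i) = ?N (\<theta> i + \<delta> i)" for i
    using n normal_density_shift[of "real n" "\<theta> i" _ "\<delta> i"]
    by (subst density_density_eq) (auto simp: ennreal_mult'[symmetric])
  have "integral\<^sup>N (?N (\<theta> i)) (?g i) = emeasure (density (?N (\<theta> i)) (?g i)) UNIV" for i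
    by (subst emeasure_density) auto
  then have one: "integral\<^sup>N (?N (\<theta> i)) (?g i) = 1" for i
    using prob_space.emeasure_space_1[OF prob_space_normal[OF n, of "\<theta> i + \<delta> i"]] unfolding dens by simp
  have "data_law n (\<lambda>i. \<theta> i + \<delta> i) = PiM UNIV (\<lambda>i. density (?N (\<theta> i)) (?g i))"
    unfolding data_law_def dens ..
  also have "\<dots> = density (PiM UNIV (\<lambda>i. ?N (\<theta> i))) (\<lambda>\<omega>. \<Prod>i\<in>J. ?g i (\<omega> i))"
    using J one by (intro PiM_density) auto
  also have "(\<lambda>\<omega>. \<Prod>i\<in>J. ?g i (\<omega> i)) = (\<lambda>y. ennreal (likelihood_ratio n \<theta> J \<delta> y))"
    by (simp add: likelihood_ratio_def exp_sum J prod_ennreal)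
  finally show ?thesis
    unfolding data_law_def .
qed

text \<open>The auxiliary uniforms have the same law for every parameter, so the change of measure
  is applied to the data for each fixed \<open>u\<close>, which covers randomized
  estimators.\<close>

lemma nn_integral_law_shift:
  assumes n: "0 < n" and J: "finite J" "\<And>i. i \<notin> J \<Longrightarrow> \<delta> i = 0"
    and f: "f \<in> borel_measurable ((\<Pi>\<^sub>M i\<in>UNIV. borel) \<Otimes>\<^sub>M (\<Pi>\<^sub>M i\<in>UNIV. borel))"
  shows "(\<integral>\<^sup>+\<omega>. ennreal (likelihood_ratio n \<theta> J \<delta> (fst \<omega>)) * f \<omega> \<partial>law n \<theta>)
    = (\<integral>\<^sup>+\<omega>. f \<omega> \<partial>law n (\<lambda>i. \<theta> i + \<delta> i))"
proof -
  have f': "f \<in> borel_measurable (data_law n \<theta>' \<Otimes>\<^sub>M aux_law)" for \<theta>'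
    using f by (subst measurable_cong_sets[OF sets_pair_measure_cong[OF sets_data_law sets_aux_law] refl])
  note f'[measurable]
  have [measurable]: "likelihood_ratio n \<theta> J \<delta> \<in> borel_measurable (data_law n \<theta>)"
    by measurable
  have fu: "(\<lambda>y. f (y, u)) \<in> borel_measurable (data_law n \<theta>)" if "u \<in> space aux_law" for u
    using that by measurable
  have "(\<integral>\<^sup>+\<omega>. f \<omega> \<partial>law n (\<lambda>i. \<theta> i + \<delta> i))
      = (\<integral>\<^sup>+u. (\<integral>\<^sup>+y. f (y, u) \<partial>data_law n (\<lambda>i. \<theta> i + \<delta> i)) \<partial>aux_law)"
    by (rule nn_integral_law_snd[OF n f'])
  also have "\<dots> = (\<integral>\<^sup>+u. (\<integral>\<^sup>+y. ennreal (likelihood_ratio n \<theta> J \<delta> y) * f (y, u) \<partial>data_law n \<theta>) \<partial>aux_law)"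
  proof (rule nn_integral_cong)
    fix u assume "u \<in> space aux_law"
    have shift: "data_law n (\<lambda>i. \<theta> i + \<delta> i) = density (data_law n \<theta>) (\<lambda>y. ennreal (likelihood_ratio n \<theta> J \<delta> y))"
      by (rule data_law_shift[OF n J])
    show "(\<integral>\<^sup>+y. f (y, u) \<partial>data_law n (\<lambda>i. \<theta> i + \<delta> i))
        = (\<integral>\<^sup>+y. ennreal (likelihood_ratio n \<theta> J \<delta> y) * f (y, u) \<partial>data_law n \<theta>)"
      unfolding shift using fu[OF \<open>u \<in> space aux_law\<close>] by (intro nn_integral_density) auto
  qed
  also have "\<dots> = (\<integral>\<^sup>+\<omega>. ennreal (likelihood_ratio n \<theta> J \<delta> (fst \<omega>)) * f \<omega> \<partial>law n \<theta>)"
    by (subst nn_integral_law_snd[OF n]) auto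
  finally show ?thesis ..
qed

lemma prob_space_law: "0 < n \<Longrightarrow> prob_space (law n \<theta>)"
  unfolding law_def
  by (rule prob_space_pair) (simp_all add: prob_space_data_law prob_space_aux_law)

lemma nn_integral_likelihood_ratio:
  assumes n: "0 < n" and J: "finite J" "\<And>i. i \<notin> J \<Longrightarrow> \<delta> i = 0"
  shows "(\<integral>\<^sup>+\<omega>. ennreal (likelihood_ratio n \<theta> J \<delta> (fst \<omega>)) \<partial>law n \<theta>) = 1"
  using nn_integral_law_shift[OF n J, where f = "\<lambda>_. 1"]
    prob_space.emeasure_space_1[OF prob_space_law[OF n]] by simp

text \<open>Polarization in the exponent: the product of the ratios for \<open>\<delta>\<close> and
  \<open>\<delta>'\<close> is the ratio for their sum, which integrates to 1, times the
  deterministic factor exp(n \<langle>\<delta>, \<delta>'\<rangle>).\<close>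

lemma nn_integral_likelihood_ratio_mult:
  assumes n: "0 < n" and J: "finite J" "\<And>i. i \<notin> J \<Longrightarrow> \<delta> i = 0" "\<And>i. i \<notin> J \<Longrightarrow> \<delta>' i = 0"
  shows "(\<integral>\<^sup>+\<omega>. ennreal (likelihood_ratio n \<theta> J \<delta> (fst \<omega>) * likelihood_ratio n \<theta> J \<delta>' (fst \<omega>)) \<partial>law n \<theta>)
    = ennreal (exp (real n * (\<Sum>i\<in>J. \<delta> i * \<delta>' i)))"
proof -
  have "likelihood_ratio n \<theta> J \<delta> y * likelihood_ratio n \<theta> J \<delta>' y
      = exp (real n * (\<Sum>i\<in>J. \<delta> i * \<delta>' i)) * likelihood_ratio n \<theta> J (\<lambda>i. \<delta> i + \<delta>' i) y" for y
    unfolding likelihood_ratio_def exp_add[symmetric] sum_distrib_left sum.distrib[symmetric]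
    by (intro arg_cong[where f = exp] sum.cong) (auto simp: algebra_simps power2_eq_square)
  then have "(\<integral>\<^sup>+\<omega>. ennreal (likelihood_ratio n \<theta> J \<delta> (fst \<omega>) * likelihood_ratio n \<theta> J \<delta>' (fst \<omega>)) \<partial>law n \<theta>)
      = (\<integral>\<^sup>+\<omega>. ennreal (exp (real n * (\<Sum>i\<in>J. \<delta> i * \<delta>' i)))
          * ennreal (likelihood_ratio n \<theta> J (\<lambda>i. \<delta> i + \<delta>' i) (fst \<omega>)) \<partial>law n \<theta>)"
    by (simp add: ennreal_mult')
  also have "\<dots> = ennreal (exp (real n * (\<Sum>i\<in>J. \<delta> i * \<delta>' i)))
      * (\<integral>\<^sup>+\<omega>. ennreal (likelihood_ratio n \<theta> J (\<lambda>i. \<delta> i + \<delta>' i) (fst \<omega>)) \<partial>law n \<theta>)"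
    unfolding law_def by (rule nn_integral_cmult) measurable
  also have "\<dots> = ennreal (exp (real n * (\<Sum>i\<in>J. \<delta> i * \<delta>' i)))"
    using J by (subst nn_integral_likelihood_ratio[OF n]) auto
  finally show ?thesis .
qed

text \<open>Minimizing over \<open>a\<close> leaves \<Delta>^2 L / (1 + L), and 1 / (1 + L) lies
  above its tangent-type bound 2 s - s^2 (1 + L). The resulting bound is a quadratic polynomial in
  \<open>L\<close>, so after integration only two moments are needed. Multiplication by 1 + L
  displays the gap as a sum of nonnegative terms.\<close>

lemma weighted_squares_ge:
  fixes a L \<Delta> s :: real
  assumes "0 \<le> L"
  shows "2 * \<Delta>\<^sup>2 * s * L \<le> a\<^sup>2 + L * (\<Delta> - a)\<^sup>2 + \<Delta>\<^sup>2 * s\<^sup>2 * (L + L\<^sup>2)"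
proof -
  let ?E = "a\<^sup>2 + L * (\<Delta> - a)\<^sup>2 + \<Delta>\<^sup>2 * s\<^sup>2 * (L + L\<^sup>2) - 2 * \<Delta>\<^sup>2 * s * L"
  have "(1 + L) * ?E = ((1 + L) * a - L * \<Delta>)\<^sup>2 + L * \<Delta>\<^sup>2 * (1 - s * (1 + L))\<^sup>2"
    by algebra
  also have "\<dots> \<ge> 0"
    using assms by simp
  finally have "0 \<le> (1 + L) * ?E" .
  then have "0 \<le> ?E"
    using assms by (subst (asm) zero_le_mult_iff) auto
  then show ?thesis by linarith
qed

text \<open>If \<open>a \<le> \<Delta>\<close>, lowering every separation \<open>D w\<close> to
  \<open>\<Delta>\<close> only shrinks the squares, and the two-point inequality applies. If
  \<open>a > \<Delta>\<close>, the error a^2 at the centre alone exceeds \<Delta>^2, and 2 s L \<le>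
  1 + (s L)^2 finishes.\<close>

lemma mixture_pointwise:
  fixes l D :: "'w \<Rightarrow> real" and a \<Delta> s :: real
  assumes W: "finite W" "W \<noteq> {}" and l: "\<And>w. w \<in> W \<Longrightarrow> 0 \<le> l w"
    and D: "\<And>w. w \<in> W \<Longrightarrow> \<Delta> \<le> D w" and "0 \<le> \<Delta>"
  defines "L \<equiv> (\<Sum>w\<in>W. l w)"
  shows "2 * \<Delta>\<^sup>2 * s * L \<le> a\<^sup>2 + (\<Sum>w\<in>W. l w * (a - D w)\<^sup>2) + \<Delta>\<^sup>2 * s\<^sup>2 * (L + L\<^sup>2)"
proof (cases "a \<le> \<Delta>")
  case True
  have "L * (\<Delta> - a)\<^sup>2 \<le> (\<Sum>w\<in>W. l w * (a - D w)\<^sup>2)"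
    unfolding L_def sum_distrib_right
  proof (intro sum_mono mult_left_mono l)
    fix w assume "w \<in> W"
    then show "(\<Delta> - a)\<^sup>2 \<le> (a - D w)\<^sup>2"
      using D[of w] True by (subst power2_commute[of a]) (auto intro!: power_mono)
  qed
  moreover have "0 \<le> L"
    unfolding L_def by (intro sum_nonneg l)
  ultimately show ?thesis
    using weighted_squares_ge[of L \<Delta> s a] by linarith
next
  case False
  have "0 \<le> L" "0 \<le> (\<Sum>w\<in>W. l w * (a - D w)\<^sup>2)"
    unfolding L_def by (auto intro!: sum_nonneg l mult_nonneg_nonneg)
  moreover have "\<Delta>\<^sup>2 * (2 * (s * L)) \<le> \<Delta>\<^sup>2 * (1 + (s * L)\<^sup>2)"
    using sum_squares_bound[of 1 "s * L"] by (intro mult_left_mono) auto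
  moreover have "\<Delta>\<^sup>2 \<le> a\<^sup>2"
    using False assms(5) by (intro power_mono) auto
  moreover have "0 \<le> \<Delta>\<^sup>2 * s\<^sup>2 * L"
    using \<open>0 \<le> L\<close> by simp
  moreover have "\<Delta>\<^sup>2 * (2 * (s * L)) = 2 * \<Delta>\<^sup>2 * s * L" "\<Delta>\<^sup>2 * (1 + (s * L)\<^sup>2) = \<Delta>\<^sup>2 + \<Delta>\<^sup>2 * s\<^sup>2 * L\<^sup>2"
    "\<Delta>\<^sup>2 * s\<^sup>2 * (L + L\<^sup>2) = \<Delta>\<^sup>2 * s\<^sup>2 * L + \<Delta>\<^sup>2 * s\<^sup>2 * L\<^sup>2"
    by (simp_all add: power_mult_distrib algebra_simps)
  ultimately show ?thesis
    by linarith
qed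

text \<open>Le Cam's method with the two hypotheses \<open>\<theta>\<close> and a uniform mixture of shifts of \<open>\<theta>\<close>; the
  mixed likelihood ratio has second moment at most \<open>B\<close>.\<close>

lemma mixture_lower_bound:
  fixes \<delta> :: "'w \<Rightarrow> nat \<Rightarrow> real"
  assumes n: "0 < n" and T: "T \<in> estimators"
    and J: "finite J" "\<And>w i. w \<in> W \<Longrightarrow> i \<notin> J \<Longrightarrow> \<delta> w i = 0"
    and W: "finite W" "W \<noteq> {}"
    and \<Delta>: "0 \<le> \<Delta>" "\<And>w. w \<in> W \<Longrightarrow> Q \<theta> + \<Delta> \<le> Q (\<lambda>i. \<theta> i + \<delta> w i)"
    and B: "(\<Sum>w\<in>W. \<Sum>w'\<in>W. exp (real n * (\<Sum>i\<in>J. \<delta> w i * \<delta> w' i))) \<le> B * (real (card W))\<^sup>2"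
    and R: "mse n T \<theta> \<le> R" "\<And>w. w \<in> W \<Longrightarrow> mse n T (\<lambda>i. \<theta> i + \<delta> w i) \<le> R"
  shows "ennreal (\<Delta>\<^sup>2 / (1 + B)) \<le> 2 * R"
proof (cases R)
  case top
  then show ?thesis by (simp add: ennreal_mult_top)
next
  case (real r)
  define m where "m = real (card W)"
  have m: "0 < m" using W by (simp add: m_def card_gt_0_iff)
  have "0 \<le> B"
  proof -
    have "0 \<le> (\<Sum>w\<in>W. \<Sum>w'\<in>W. exp (real n * (\<Sum>i\<in>J. \<delta> w i * \<delta> w' i)))"
      by (intro sum_nonneg) simp
    then have "0 \<le> B * m\<^sup>2"
      using B unfolding m_def by (rule order_trans)
    then show ?thesis
      using m by (simp add: zero_le_mult_iff)
  qed
  \<comment> \<open>The factor 1/m is built into the weights, so \<open>L\<close> is the likelihood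
    ratio of the uniform mixture and has mean 1.\<close>
  define l where "l w \<omega> = likelihood_ratio n \<theta> J (\<delta> w) (fst \<omega>) / m" for w and \<omega> :: outcome
  define L where "L \<omega> = (\<Sum>w\<in>W. l w \<omega>)" for \<omega>
  \<comment> \<open>This \<open>s\<close> maximizes 2 s - s^2 (1 + B), the coefficient of \<Delta>^2
    that remains after integrating with first moment 1 and second moment at most
    \<open>B\<close>.\<close>
  define s where "s = 1 / (1 + B)"
  let ?P = "law n \<theta>"
  let ?S = "(\<Pi>\<^sub>M i\<in>UNIV. borel) \<Otimes>\<^sub>M (\<Pi>\<^sub>M i\<in>UNIV. borel) :: outcome measure"
  have sets_P [measurable_cong]: "sets ?P = sets ?S"
    unfolding law_def by (intro sets_pair_measure_cong sets_data_law sets_aux_law)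
  have [measurable]: "T \<in> borel_measurable ?S"
    using T by (simp add: estimators_def)
  have l_meas [measurable]: "l w \<in> borel_measurable ?S" for w
    unfolding l_def[abs_def] by measurable
  have L_meas [measurable]: "L \<in> borel_measurable ?S"
    unfolding L_def[abs_def] by measurable
  have l0: "0 \<le> l w \<omega>" for w \<omega>
    using m by (simp add: l_def likelihood_ratio_def)
  then have L0: "0 \<le> L \<omega>" for \<omega>
    unfolding L_def by (intro sum_nonneg)
  have int_l: "(\<integral>\<^sup>+\<omega>. ennreal (l w \<omega>) * f \<omega> \<partial>?P) = ennreal (1 / m) * (\<integral>\<^sup>+\<omega>. f \<omega> \<partial>law n (\<lambda>i. \<theta> i + \<delta> w i))"
    if w: "w \<in> W" and [measurable]: "f \<in> borel_measurable ?S" for w f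
  proof -
    have "(\<integral>\<^sup>+\<omega>. ennreal (l w \<omega>) * f \<omega> \<partial>?P)
        = (\<integral>\<^sup>+\<omega>. ennreal (1 / m) * (ennreal (likelihood_ratio n \<theta> J (\<delta> w) (fst \<omega>)) * f \<omega>) \<partial>?P)"
      using m by (simp add: l_def mult.assoc[symmetric] ennreal_mult''[symmetric] likelihood_ratio_def)
    also have "\<dots> = ennreal (1 / m) * (\<integral>\<^sup>+\<omega>. ennreal (likelihood_ratio n \<theta> J (\<delta> w) (fst \<omega>)) * f \<omega> \<partial>?P)"
      by (rule nn_integral_cmult) measurable
    finally show ?thesis
      using nn_integral_law_shift[OF n J(1) J(2)[OF w]] that(2) by simp
  qed
  have int_L: "(\<integral>\<^sup>+\<omega>. ennreal (L \<omega>) \<partial>?P) = 1"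
  proof -
    have "(\<integral>\<^sup>+\<omega>. ennreal (L \<omega>) \<partial>?P) = (\<integral>\<^sup>+\<omega>. (\<Sum>w\<in>W. ennreal (l w \<omega>)) \<partial>?P)"
      using l0 by (simp add: L_def sum_ennreal)
    also have "\<dots> = (\<Sum>w\<in>W. \<integral>\<^sup>+\<omega>. ennreal (l w \<omega>) \<partial>?P)"
      by (rule nn_integral_sum) measurable
    also have "\<dots> = (\<Sum>w\<in>W. ennreal (1 / m))"
    proof (intro sum.cong refl)
      fix w assume "w \<in> W"
      then show "(\<integral>\<^sup>+\<omega>. ennreal (l w \<omega>) \<partial>?P) = ennreal (1 / m)"
        using int_l[of w "\<lambda>_. 1"] prob_space.emeasure_space_1[OF prob_space_law[OF n]] by simp
    qed
    also have "\<dots> = 1"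
      using m by (simp add: m_def ennreal_of_nat_eq_real_of_nat ennreal_mult'[symmetric])
    finally show ?thesis .
  qed
  have int_L2: "(\<integral>\<^sup>+\<omega>. ennreal ((L \<omega>)\<^sup>2) \<partial>?P) \<le> ennreal B"
  proof -
    have "(\<integral>\<^sup>+\<omega>. ennreal ((L \<omega>)\<^sup>2) \<partial>?P) = (\<integral>\<^sup>+\<omega>. (\<Sum>w\<in>W. \<Sum>w'\<in>W. ennreal (l w \<omega> * l w' \<omega>)) \<partial>?P)"
      using l0 by (simp add: L_def power2_eq_square sum_product sum_ennreal sum_nonneg)
    also have "\<dots> = (\<Sum>w\<in>W. \<Sum>w'\<in>W. \<integral>\<^sup>+\<omega>. ennreal (l w \<omega> * l w' \<omega>) \<partial>?P)"
      by (subst nn_integral_sum, measurable)+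
    also have "\<dots> = (\<Sum>w\<in>W. \<Sum>w'\<in>W. ennreal (exp (real n * (\<Sum>i\<in>J. \<delta> w i * \<delta> w' i)) / m\<^sup>2))"
    proof (intro sum.cong refl)
      fix w w' assume w: "w \<in> W" "w' \<in> W"
      have "(\<integral>\<^sup>+\<omega>. ennreal (l w \<omega> * l w' \<omega>) \<partial>?P)
          = (\<integral>\<^sup>+\<omega>. ennreal (1 / m\<^sup>2) * ennreal (likelihood_ratio n \<theta> J (\<delta> w) (fst \<omega>)
              * likelihood_ratio n \<theta> J (\<delta> w') (fst \<omega>)) \<partial>?P)"
        using m by (simp add: l_def ennreal_mult'[symmetric] power2_eq_square)
      also have "\<dots> = ennreal (1 / m\<^sup>2) * (\<integral>\<^sup>+\<omega>. ennreal (likelihood_ratio n \<theta> J (\<delta> w) (fst \<omega>)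
              * likelihood_ratio n \<theta> J (\<delta> w') (fst \<omega>)) \<partial>?P)"
        by (rule nn_integral_cmult) measurable
      also have "\<dots> = ennreal (exp (real n * (\<Sum>i\<in>J. \<delta> w i * \<delta> w' i)) / m\<^sup>2)"
        using nn_integral_likelihood_ratio_mult[OF n J(1) J(2)[OF w(1)] J(2)[OF w(2)]]
        by (simp add: ennreal_mult'[symmetric])
      finally show "(\<integral>\<^sup>+\<omega>. ennreal (l w \<omega> * l w' \<omega>) \<partial>?P)
          = ennreal (exp (real n * (\<Sum>i\<in>J. \<delta> w i * \<delta> w' i)) / m\<^sup>2)" .
    qed
    also have "\<dots> = ennreal ((\<Sum>w\<in>W. \<Sum>w'\<in>W. exp (real n * (\<Sum>i\<in>J. \<delta> w i * \<delta> w' i))) / m\<^sup>2)"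
      by (simp add: sum_ennreal sum_nonneg sum_divide_distrib)
    also have "\<dots> \<le> ennreal B"
      using B m by (intro ennreal_leI) (simp add: m_def[symmetric] divide_le_eq)
    finally show ?thesis .
  qed
  have "ennreal (2 * \<Delta>\<^sup>2 * s) = ennreal (2 * \<Delta>\<^sup>2 * s) * (\<integral>\<^sup>+\<omega>. ennreal (L \<omega>) \<partial>?P)"
    by (simp add: int_L)
  also have "\<dots> = (\<integral>\<^sup>+\<omega>. ennreal (2 * \<Delta>\<^sup>2 * s) * ennreal (L \<omega>) \<partial>?P)"
    by (rule nn_integral_cmult[symmetric]) measurable
  also have "\<dots> \<le> (\<integral>\<^sup>+\<omega>. ennreal ((T \<omega> - Q \<theta>)\<^sup>2)
      + (\<Sum>w\<in>W. ennreal (l w \<omega>) * ennreal ((T \<omega> - Q (\<lambda>i. \<theta> i + \<delta> w i))\<^sup>2))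
      + ennreal (\<Delta>\<^sup>2 * s\<^sup>2) * (ennreal (L \<omega>) + ennreal ((L \<omega>)\<^sup>2)) \<partial>?P)"
  proof (rule nn_integral_mono)
    fix \<omega>
    have "2 * \<Delta>\<^sup>2 * s * L \<omega> \<le> (T \<omega> - Q \<theta>)\<^sup>2
        + (\<Sum>w\<in>W. l w \<omega> * ((T \<omega> - Q \<theta>) - (Q (\<lambda>i. \<theta> i + \<delta> w i) - Q \<theta>))\<^sup>2)
        + \<Delta>\<^sup>2 * s\<^sup>2 * (L \<omega> + (L \<omega>)\<^sup>2)"
      unfolding L_def using \<Delta>(2) by (intro mixture_pointwise W l0 \<Delta>(1)) (simp add: le_diff_eq add.commute)
    then have "ennreal (2 * \<Delta>\<^sup>2 * s * L \<omega>) \<le> ennreal ((T \<omega> - Q \<theta>)\<^sup>2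
        + (\<Sum>w\<in>W. l w \<omega> * (T \<omega> - Q (\<lambda>i. \<theta> i + \<delta> w i))\<^sup>2)
        + \<Delta>\<^sup>2 * s\<^sup>2 * (L \<omega> + (L \<omega>)\<^sup>2))"
      by (intro ennreal_leI) simp
    moreover have "ennreal (\<Delta>\<^sup>2 * s\<^sup>2) * (ennreal (L \<omega>) + ennreal ((L \<omega>)\<^sup>2)) = ennreal (\<Delta>\<^sup>2 * s\<^sup>2 * (L \<omega> + (L \<omega>)\<^sup>2))"
      using L0[of \<omega>] by (simp add: ennreal_mult)
    ultimately show "ennreal (2 * \<Delta>\<^sup>2 * s) * ennreal (L \<omega>) \<le> ennreal ((T \<omega> - Q \<theta>)\<^sup>2)
      + (\<Sum>w\<in>W. ennreal (l w \<omega>) * ennreal ((T \<omega> - Q (\<lambda>i. \<theta> i + \<delta> w i))\<^sup>2))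
      + ennreal (\<Delta>\<^sup>2 * s\<^sup>2) * (ennreal (L \<omega>) + ennreal ((L \<omega>)\<^sup>2))"
      using l0 L0[of \<omega>] \<open>0 \<le> B\<close>
      by (simp add: ennreal_mult'[symmetric] ennreal_mult''[symmetric] sum_ennreal sum_nonneg s_def)
  qed
  also have "\<dots> = (\<integral>\<^sup>+\<omega>. ennreal ((T \<omega> - Q \<theta>)\<^sup>2) \<partial>?P)
      + (\<Sum>w\<in>W. \<integral>\<^sup>+\<omega>. ennreal (l w \<omega>) * ennreal ((T \<omega> - Q (\<lambda>i. \<theta> i + \<delta> w i))\<^sup>2) \<partial>?P)
      + ennreal (\<Delta>\<^sup>2 * s\<^sup>2) * ((\<integral>\<^sup>+\<omega>. ennreal (L \<omega>) \<partial>?P) + (\<integral>\<^sup>+\<omega>. ennreal ((L \<omega>)\<^sup>2) \<partial>?P))"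
    by (simp add: nn_integral_add nn_integral_sum nn_integral_cmult)
  also have "\<dots> \<le> R + R + ennreal (\<Delta>\<^sup>2 * s\<^sup>2) * (1 + ennreal B)"
  proof (intro add_mono mult_left_mono)
    show "(\<integral>\<^sup>+\<omega>. ennreal ((T \<omega> - Q \<theta>)\<^sup>2) \<partial>?P) \<le> R"
      using R(1) by (simp add: mse_def)
    have "(\<Sum>w\<in>W. \<integral>\<^sup>+\<omega>. ennreal (l w \<omega>) * ennreal ((T \<omega> - Q (\<lambda>i. \<theta> i + \<delta> w i))\<^sup>2) \<partial>?P)
        \<le> (\<Sum>w\<in>W. ennreal (1 / m) * R)"
    proof (rule sum_mono)
      fix w assume w: "w \<in> W"
      then show "(\<integral>\<^sup>+\<omega>. ennreal (l w \<omega>) * ennreal ((T \<omega> - Q (\<lambda>i. \<theta> i + \<delta> w i))\<^sup>2) \<partial>?P) \<le> ennreal (1 / m) * R"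
        using R(2)[OF w] by (subst int_l) (auto simp: mse_def intro!: mult_left_mono)
    qed
    also have "\<dots> = R"
      using m real by (simp add: m_def ennreal_of_nat_eq_real_of_nat ennreal_mult'[symmetric] ennreal_mult''[symmetric])
    finally show "(\<Sum>w\<in>W. \<integral>\<^sup>+\<omega>. ennreal (l w \<omega>) * ennreal ((T \<omega> - Q (\<lambda>i. \<theta> i + \<delta> w i))\<^sup>2) \<partial>?P) \<le> R" .
  qed (use int_L int_L2 in auto)
  also have "\<dots> = ennreal (r + r + \<Delta>\<^sup>2 * s\<^sup>2 * (1 + B))"
    using real \<open>0 \<le> B\<close> by (simp add: ennreal_mult'[symmetric] ennreal_plus[symmetric] ennreal_1[symmetric] del: ennreal_plus ennreal_1)
  finally have "2 * \<Delta>\<^sup>2 * s \<le> r + r + \<Delta>\<^sup>2 * s\<^sup>2 * (1 + B)"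
    using real \<open>0 \<le> B\<close> by (subst (asm) ennreal_le_iff) auto
  also have "\<Delta>\<^sup>2 * s\<^sup>2 * (1 + B) = \<Delta>\<^sup>2 * s"
    using \<open>0 \<le> B\<close> by (simp add: s_def power2_eq_square)
  finally have "\<Delta>\<^sup>2 / (1 + B) \<le> 2 * r"
    by (simp add: s_def)
  then show ?thesis
    using real by (simp add: ennreal_mult'[symmetric] ennreal_leI flip: ennreal_numeral)
qed

subsection \<open>Minimax lower bound and comparison of the estimators\<close>

lemma finite_support_l2:
  assumes "finite J" "\<And>i. i \<notin> J \<Longrightarrow> \<delta> i = 0"
  shows "\<delta> \<in> l2" "sqnorm \<delta> = (\<Sum>i\<in>J. (\<delta> i)\<^sup>2)"
proof -
  have "(\<lambda>i. (\<delta> i)\<^sup>2) sums (\<Sum>i\<in>J. (\<delta> i)\<^sup>2)"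
    using assms by (intro sums_finite) auto
  then show "\<delta> \<in> l2" "sqnorm \<delta> = (\<Sum>i\<in>J. (\<delta> i)\<^sup>2)"
    by (auto simp: l2_def sqnorm_def sums_iff)
qed

lemma l2_uminus: "a \<in> l2 \<Longrightarrow> (\<lambda>i. - a i) \<in> l2"
  by (simp add: l2_def)

lemma l2_add: "a \<in> l2 \<Longrightarrow> b \<in> l2 \<Longrightarrow> (\<lambda>i. a i + b i) \<in> l2"
  using l2_diff[of a "\<lambda>i. - b i"] by (simp add: l2_uminus)

lemma Q_add_finite_support:
  assumes "\<theta> \<in> l2" and J: "finite J" "\<And>i. i \<notin> J \<Longrightarrow> \<delta> i = 0"
  shows "Q (\<lambda>i. \<theta> i + \<delta> i) = Q \<theta> + (\<Sum>i\<in>J. 2 * \<theta> i * \<delta> i + (\<delta> i)\<^sup>2)"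
proof -
  have "(\<lambda>i. (\<theta> i)\<^sup>2 + (2 * \<theta> i * \<delta> i + (\<delta> i)\<^sup>2)) sums (sqnorm \<theta> + (\<Sum>i\<in>J. 2 * \<theta> i * \<delta> i + (\<delta> i)\<^sup>2))"
    using assms unfolding sqnorm_def l2_def by (intro sums_add sums_finite) (auto simp: summable_sums)
  also have "(\<lambda>i. (\<theta> i)\<^sup>2 + (2 * \<theta> i * \<delta> i + (\<delta> i)\<^sup>2)) = (\<lambda>i. (\<theta> i + \<delta> i)\<^sup>2)"
    by (auto simp: power2_sum)
  finally show ?thesis
    by (simp add: Q_def sqnorm_def sums_iff)
qed

lemma P_SA_add_finite_support:
  assumes "\<theta>h \<in> l2" "finite J" "\<And>i. i \<notin> J \<Longrightarrow> \<delta> i = 0" "(\<Sum>i\<in>J. (\<delta> i)\<^sup>2) \<le> r"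
  shows "(\<lambda>i. \<theta>h i + \<delta> i) \<in> P_SA \<theta>h r"
proof -
  have "sqnorm (\<lambda>i. \<theta>h i - (\<theta>h i + \<delta> i)) = sqnorm \<delta>"
    by (simp add: sqnorm_def)
  then show ?thesis
    using finite_support_l2[of J \<delta>] assms l2_add[of \<theta>h \<delta>] by (simp add: P_SA_def)
qed

lemma P_SA_center: "\<theta>h \<in> l2 \<Longrightarrow> 0 \<le> r \<Longrightarrow> \<theta>h \<in> P_SA \<theta>h r"
  using P_SA_add_finite_support[of \<theta>h "{}" "\<lambda>_. 0" r] by simp

lemma ennreal_half_le: "ennreal x \<le> 2 * R \<Longrightarrow> ennreal (x / 2) \<le> R"
proof (cases R)
  case (real r)
  assume "ennreal x \<le> 2 * R"
  then have "x \<le> 2 * r"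
    using real by (simp add: ennreal_mult'[symmetric] flip: ennreal_numeral)
  then show ?thesis
    using real by (simp add: ennreal_leI)
qed simp

lemma minimax_risk_ge_mixture:
  fixes \<delta> :: "'w \<Rightarrow> nat \<Rightarrow> real"
  assumes n: "0 < n" and \<theta>h: "\<theta>h \<in> l2"
    and J: "finite J" "\<And>w i. w \<in> W \<Longrightarrow> i \<notin> J \<Longrightarrow> \<delta> w i = 0"
    and W: "finite W" "W \<noteq> {}"
    and r: "\<And>w. w \<in> W \<Longrightarrow> (\<Sum>i\<in>J. (\<delta> w i)\<^sup>2) \<le> r"
    and \<Delta>: "0 \<le> \<Delta>" "\<And>w. w \<in> W \<Longrightarrow> \<Delta> \<le> (\<Sum>i\<in>J. 2 * \<theta>h i * \<delta> w i + (\<delta> w i)\<^sup>2)"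
    and B: "(\<Sum>w\<in>W. \<Sum>w'\<in>W. exp (real n * (\<Sum>i\<in>J. \<delta> w i * \<delta> w' i))) \<le> B * (real (card W))\<^sup>2"
  shows "ennreal (\<Delta>\<^sup>2 / (1 + B) / 2) \<le> minimax_risk n (P_SA \<theta>h r)"
  unfolding minimax_risk_def
proof (rule INF_greatest)
  fix T assume T: "T \<in> estimators"
  obtain w where "w \<in> W" using W by blast
  then have "0 \<le> r"
    using r[of w] by (meson order_trans sum_nonneg zero_le_power2)
  have "ennreal (\<Delta>\<^sup>2 / (1 + B)) \<le> 2 * (SUP \<theta>\<in>P_SA \<theta>h r. mse n T \<theta>)"
  proof (rule mixture_lower_bound[OF n T J W \<Delta>(1) _ B])
    show "Q \<theta>h + \<Delta> \<le> Q (\<lambda>i. \<theta>h i + \<delta> w i)" if "w \<in> W" for w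
      using \<Delta>(2)[OF that] Q_add_finite_support[OF \<theta>h J(1) J(2)[OF that]] by simp
    show "mse n T \<theta>h \<le> (SUP \<theta>\<in>P_SA \<theta>h r. mse n T \<theta>)"
      using \<theta>h \<open>0 \<le> r\<close> by (intro SUP_upper P_SA_center)
    show "mse n T (\<lambda>i. \<theta>h i + \<delta> w i) \<le> (SUP \<theta>\<in>P_SA \<theta>h r. mse n T \<theta>)" if "w \<in> W" for w
      by (intro SUP_upper P_SA_add_finite_support[OF \<theta>h J(1) J(2)[OF that] r[OF that]])
  qed
  then show "ennreal (\<Delta>\<^sup>2 / (1 + B) / 2) \<le> (SUP \<theta>\<in>P_SA \<theta>h r. mse n T \<theta>)"
    by (rule ennreal_half_le)
qed

text \<open>Since the sequence is infinite, the mixture may range over so many single-coordinate shifts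
  of squared size \<open>r\<close> that it is indistinguishable from its center, whatever \<open>n\<close> and \<open>r\<close> are.\<close>

lemma minimax_risk_ge_bias:
  assumes n: "0 < n" and \<theta>h: "\<theta>h \<in> l2" and r: "0 \<le> r"
  shows "ennreal (r\<^sup>2 / 6) \<le> minimax_risk n (P_SA \<theta>h r)"
proof -
  \<comment> \<open>With at least exp(n r) shifts, the m diagonal terms of the second moment sum to
    at most m^2, like the off-diagonal ones, which gives \<open>B = 2\<close>. The factor 6 in the
    claim is (1 + 2) * 2.\<close>
  obtain m where m: "exp (real n * r) \<le> real m"
    using real_arch_simple by blast
  moreover have "0 < exp (real n * r)" by simp
  ultimately have m0: "0 < real m" by linarith
  \<comment> \<open>The sign is that of \<open>\<theta>h w\<close>, so the cross term is nonnegative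
    and every shift raises \<open>Q\<close> by at least \<open>r\<close>.\<close>
  define \<delta> where "\<delta> w i = (if i = w then (if 0 \<le> \<theta>h w then sqrt r else - sqrt r) else 0)" for w i :: nat
  have sq: "(\<delta> w w)\<^sup>2 = r" for w
    using r by (simp add: \<delta>_def)
  have pos: "0 \<le> \<theta>h w * \<delta> w w" for w
    using r by (simp add: \<delta>_def mult_nonpos_nonneg)
  have "(\<Sum>w<m. \<Sum>w'<m. exp (real n * (\<Sum>i<m. \<delta> w i * \<delta> w' i))) \<le> (\<Sum>w<m. \<Sum>w'<m. 1 + (if w' = w then exp (real n * r) else 0))"
  proof (intro sum_mono)
    fix w w' assume w: "w \<in> {..<m}" "w' \<in> {..<m}"
    have "(\<Sum>i<m. \<delta> w i * \<delta> w' i) = (\<Sum>i<m. if i = w then \<delta> w w * \<delta> w' w else 0)"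
      by (intro sum.cong) (auto simp: \<delta>_def)
    also have "\<dots> = \<delta> w w * \<delta> w' w"
      using w by simp
    also have "\<dots> = (if w' = w then r else 0)"
      using sq[of w] by (auto simp: power2_eq_square) (auto simp: \<delta>_def)
    finally show "exp (real n * (\<Sum>i<m. \<delta> w i * \<delta> w' i)) \<le> 1 + (if w' = w then exp (real n * r) else 0)"
      by simp
  qed
  also have "\<dots> = real m * (real m + exp (real n * r))"
    by (simp add: sum.distrib algebra_simps)
  also have "\<dots> \<le> real m * (real m + real m)"
    using m by (intro mult_left_mono) auto
  finally have B: "(\<Sum>w<m. \<Sum>w'<m. exp (real n * (\<Sum>i<m. \<delta> w i * \<delta> w' i))) \<le> 2 * (real (card {..<m}))\<^sup>2"
    by (simp add: power2_eq_square)
  have sum_sq: "(\<Sum>i<m. (\<delta> w i)\<^sup>2) = r" if "w < m" for w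
  proof -
    have "(\<Sum>i<m. (\<delta> w i)\<^sup>2) = (\<Sum>i<m. if i = w then (\<delta> w w)\<^sup>2 else 0)"
      by (intro sum.cong) (auto simp: \<delta>_def)
    then show ?thesis using that sq by simp
  qed
  have cross: "0 \<le> (\<Sum>i<m. 2 * \<theta>h i * \<delta> w i)" for w
  proof (rule sum_nonneg)
    fix i
    show "0 \<le> 2 * \<theta>h i * \<delta> w i"
      using pos[of w] by (cases "i = w") (auto simp: \<delta>_def)
  qed
  have outside: "\<delta> w i = 0" if "w < m" "m \<le> i" for w i
    using that by (simp add: \<delta>_def)
  have "ennreal (r\<^sup>2 / (1 + 2) / 2) \<le> minimax_risk n (P_SA \<theta>h r)"
    using m0 r B cross
    by (intro minimax_risk_ge_mixture[OF n \<theta>h, where J = "{..<m}" and W = "{..<m}" and \<delta> = \<delta>])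
      (auto simp: sum_sq sum.distrib outside not_less)
  then show ?thesis by simp
qed

text \<open>\<open>Q\<close> changes fastest along \<open>\<theta>h\<close>, so the alternative is a
  shift in this direction, truncated to finitely many coordinates. Its squared length is at most
  c/n: this keeps it inside the model and bounds the second moment of the likelihood ratio by exp 1
  \<le> 3. The constant 8 is (1 + 3) * 2.\<close>

lemma minimax_risk_ge_parametric:
  assumes n: "0 < n" and \<theta>h: "\<theta>h \<in> l2" "0 < sqnorm \<theta>h"
    and c: "0 < c" "c \<le> 1" "c / real n \<le> r"
  shows "ennreal (c * sqnorm \<theta>h / (8 * real n)) \<le> minimax_risk n (P_SA \<theta>h r)"
proof -
  define H where "H = sqnorm \<theta>h"
  have "(\<lambda>m. \<Sum>i<m. (\<theta>h i)\<^sup>2) \<longlonglongrightarrow> H"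
    using \<theta>h unfolding H_def sqnorm_def l2_def by (auto intro: summable_LIMSEQ)
  then have "eventually (\<lambda>m. H / 2 < (\<Sum>i<m. (\<theta>h i)\<^sup>2)) sequentially"
    using \<theta>h(2) by (intro order_tendstoD) (auto simp: H_def)
  then obtain m where m: "H / 2 < (\<Sum>i<m. (\<theta>h i)\<^sup>2)"
    by (auto simp: eventually_sequentially)
  have mH: "(\<Sum>i<m. (\<theta>h i)\<^sup>2) \<le> H"
    using sqnorm_split[OF \<theta>h(1), of m] sqnorm_nonneg[OF l2_shift[OF \<theta>h(1)], of m] by (simp add: H_def)
  define t where "t = sqrt (c / (real n * H))"
  have H: "0 < H" using \<theta>h by (simp add: H_def)
  have t: "0 \<le> t" "t\<^sup>2 * H = c / real n"
    using n H c by (auto simp: t_def)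
  define \<delta> where "\<delta> (w :: unit) i = (if i < m then t * \<theta>h i else 0)" for w i
  have sum_sq: "(\<Sum>i<m. (\<delta> () i)\<^sup>2) = t\<^sup>2 * (\<Sum>i<m. (\<theta>h i)\<^sup>2)"
    by (simp add: \<delta>_def sum_distrib_left power_mult_distrib)
  also have "\<dots> \<le> t\<^sup>2 * H"
    using mH by (intro mult_left_mono) auto
  finally have sum_sq_le: "(\<Sum>i<m. (\<delta> () i)\<^sup>2) \<le> c / real n"
    by (simp add: t)
  have "(\<Sum>i<m. 2 * \<theta>h i * \<delta> () i) = 2 * t * (\<Sum>i<m. (\<theta>h i)\<^sup>2)"
    by (auto simp: \<delta>_def sum_distrib_left power2_eq_square intro!: sum.cong)
  moreover have "2 * t * (H / 2) \<le> 2 * t * (\<Sum>i<m. (\<theta>h i)\<^sup>2)"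
    using t m by (intro mult_left_mono) auto
  moreover have "0 \<le> (\<Sum>i<m. (\<delta> () i)\<^sup>2)"
    by (intro sum_nonneg) simp
  ultimately have \<Delta>: "t * H \<le> (\<Sum>i<m. 2 * \<theta>h i * \<delta> () i + (\<delta> () i)\<^sup>2)"
    by (simp add: sum.distrib)
  have "real n * (\<Sum>i<m. (\<delta> () i)\<^sup>2) \<le> real n * (c / real n)"
    by (intro mult_left_mono sum_sq_le) simp
  then have "real n * (\<Sum>i<m. (\<delta> () i)\<^sup>2) \<le> 1"
    using n c by simp
  then have "exp (real n * (\<Sum>i<m. (\<delta> () i)\<^sup>2)) \<le> exp 1"
    by simp
  also have "\<dots> \<le> (3 :: real)"
    by (rule exp_le)
  finally have B: "exp (real n * (\<Sum>i<m. \<delta> () i * \<delta> () i)) \<le> 3"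
    by (simp add: power2_eq_square)
  have "ennreal ((t * H)\<^sup>2 / (1 + 3) / 2) \<le> minimax_risk n (P_SA \<theta>h r)"
    using t H \<Delta> B sum_sq_le c(3)
    by (intro minimax_risk_ge_mixture[OF n \<theta>h(1), where J = "{..<m}" and W = UNIV and \<delta> = \<delta>])
      (auto simp: UNIV_unit \<delta>_def)
  also have "(t * H)\<^sup>2 / (1 + 3) / 2 = c * H / (8 * real n)"
  proof -
    have "(t * H)\<^sup>2 = t\<^sup>2 * H * H" by (simp add: power2_eq_square)
    then show ?thesis by (simp add: t)
  qed
  finally show ?thesis by (simp add: H_def)
qed

section \<open>Nonasymptotic comparison of the two estimators with each other and with the minimax
  risk\<close>

lemma mse_Qhat1:
  assumes "0 < n" "\<theta> \<in> l2" "\<theta>h \<in> l2"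
  shows "mse n (Qhat1 \<theta>h) \<theta> = ennreal ((sqnorm (\<lambda>i. \<theta>h i - \<theta> i))\<^sup>2 + 4 / real n * sqnorm \<theta>h)"
  using mse_Qhat2[OF assms, of 0] by (simp add: Qhat2_0)

lemma Delta_eq_ereal:
  assumes "mse n T' \<theta> = ennreal x" "mse n T \<theta> = ennreal y" "0 \<le> x" "0 < y"
  shows "Delta n T' T \<theta> = ereal ((x - y) / y)"
  using assms by (simp add: Delta_def)

text \<open>The term \<open>c\<close> is only controlled by \<open>c^2 \<le> H * h\<close>, so AM-GM
  splits 2 \<bar>c\<bar> into \<epsilon> H / 2 + 2 h / \<epsilon>; with the term h itself, h gets
  the coefficient \<open>b\<close>. A second AM-GM pays for 4 b h / n with h^2, which the reduction
  of the squared bias from (h + T)^2 to T^2 provides, and with 4 b^2 / n^2. The two halves of the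
  \<epsilon> budget go to the first split and to all terms of order 1/n^2 and k/n^2.\<close>

lemma mse_Qhat2_le:
  fixes T h H Hk c n k \<epsilon> h0 :: real
  assumes "0 \<le> T" "0 \<le> h" "h0 \<le> H" "0 \<le> H" "c\<^sup>2 \<le> H * h" "0 < n" "0 < \<epsilon>"
    and large: "((1 + 2 / \<epsilon>)\<^sup>2 + k) / n \<le> \<epsilon> * h0 / 2"
  shows "T\<^sup>2 + 4 / n * (H - 2 * c + h) + 4 * k / n\<^sup>2 \<le> (1 + \<epsilon>) * ((h + T)\<^sup>2 + 4 / n * H)"
proof -
  define b where "b = 1 + 2 / \<epsilon>"
  have "(2 * c)\<^sup>2 \<le> (\<epsilon> / 2 * H + 2 / \<epsilon> * h)\<^sup>2"
  proof -
    have "(\<epsilon> / 2 * H + 2 / \<epsilon> * h)\<^sup>2 - 4 * (H * h) = (\<epsilon> / 2 * H - 2 / \<epsilon> * h)\<^sup>2"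
      using assms by (simp add: power2_eq_square field_simps)
    moreover have "0 \<le> (\<epsilon> / 2 * H - 2 / \<epsilon> * h)\<^sup>2" by simp
    moreover have "(2 * c)\<^sup>2 = 4 * c\<^sup>2" by (simp add: power_mult_distrib)
    ultimately show ?thesis
      using \<open>c\<^sup>2 \<le> H * h\<close> by linarith
  qed
  then have "\<bar>2 * c\<bar> \<le> \<bar>\<epsilon> / 2 * H + 2 / \<epsilon> * h\<bar>"
    by (simp only: abs_le_square_iff)
  also have "\<dots> = \<epsilon> / 2 * H + 2 / \<epsilon> * h"
    using assms by simp
  finally have "h - 2 * c \<le> \<epsilon> / 2 * H + b * h"
    by (simp add: b_def algebra_simps)
  then have "4 / n * (h - 2 * c) \<le> 4 / n * (\<epsilon> / 2 * H + b * h)"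
    using assms by (intro mult_left_mono) auto
  also have "\<dots> = \<epsilon> * (4 / n * H) / 2 + 4 / n * (b * h)"
    by (simp add: distrib_left)
  also have "4 / n * (b * h) \<le> h\<^sup>2 + 4 * b\<^sup>2 / n\<^sup>2"
    using sum_squares_bound[of h "2 * b / n"] by (simp add: power_mult_distrib power_divide mult_ac)
  finally have linear: "4 / n * (h - 2 * c) \<le> \<epsilon> * (4 / n * H) / 2 + (h\<^sup>2 + 4 * b\<^sup>2 / n\<^sup>2)"
    by simp
  have "4 * b\<^sup>2 / n\<^sup>2 + 4 * k / n\<^sup>2 = 4 / n * ((b\<^sup>2 + k) / n)"
    by (simp add: power2_eq_square add_divide_distrib distrib_left)
  also have "\<dots> \<le> 4 / n * (\<epsilon> * H / 2)"
  proof (intro mult_left_mono order_trans[OF large[folded b_def]])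
    show "\<epsilon> * h0 / 2 \<le> \<epsilon> * H / 2" using assms by simp
  qed (use assms in simp)
  finally have const: "4 * b\<^sup>2 / n\<^sup>2 + 4 * k / n\<^sup>2 \<le> \<epsilon> * (4 / n * H) / 2"
    by simp
  have "T\<^sup>2 + 4 / n * (H - 2 * c + h) + 4 * k / n\<^sup>2 = T\<^sup>2 + 4 / n * H + 4 / n * (h - 2 * c) + 4 * k / n\<^sup>2"
    by (simp add: algebra_simps diff_divide_distrib add_divide_distrib)
  also have "\<dots> \<le> h\<^sup>2 + T\<^sup>2 + 4 / n * H + \<epsilon> * (4 / n * H)"
    using linear const by argo
  also have "h\<^sup>2 + T\<^sup>2 \<le> (h + T)\<^sup>2"
    using assms by (simp add: power2_sum)
  finally have "T\<^sup>2 + 4 / n * (H - 2 * c + h) + 4 * k / n\<^sup>2 \<le> (h + T)\<^sup>2 + 4 / n * H + \<epsilon> * (4 / n * H)"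
    by simp
  also have "\<dots> \<le> (h + T)\<^sup>2 + 4 / n * H + \<epsilon> * ((h + T)\<^sup>2 + 4 / n * H)"
    using assms by (intro add_left_mono mult_left_mono) auto
  finally show ?thesis
    by (simp only: distrib_right mult_1_left)
qed

text \<open>Writing the first \<open>k\<close> coordinates as \<theta>h - \<delta> expresses both
  errors through T, h, H and the inner product \<open>c\<close>; Cauchy-Schwarz supplies the link
  between them, and the rest is the preceding real inequality.\<close>

lemma Delta_Qhat2_le:
  assumes n: "0 < n" and \<theta>: "\<theta> \<in> P_SA \<theta>h r" and \<theta>h: "\<theta>h \<in> l2" and h0: "0 < h0" "h0 \<le> sqnorm \<theta>h"
    and \<epsilon>: "0 < \<epsilon>" and large: "((1 + 2 / \<epsilon>)\<^sup>2 + real k) / real n \<le> \<epsilon> * h0 / 2"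
  shows "Delta n (Qhat2 n \<theta>h k) (Qhat1 \<theta>h) \<theta> \<le> ereal \<epsilon>"
proof -
  have l2: "\<theta> \<in> l2" using \<theta> by (simp add: P_SA_def)
  let ?\<delta> = "\<lambda>i. \<theta>h i - \<theta> i"
  define T where "T = sqnorm (\<lambda>i. ?\<delta> (i + k))"
  define h where "h = (\<Sum>i<k. (?\<delta> i)\<^sup>2)"
  define H where "H = sqnorm \<theta>h"
  define c where "c = (\<Sum>i<k. \<theta>h i * ?\<delta> i)"
  define x where "x = T\<^sup>2 + 4 / real n * (H - 2 * c + h) + 4 * real k / (real n)\<^sup>2"
  define y where "y = (h + T)\<^sup>2 + 4 / real n * H"
  have \<delta>_l2: "?\<delta> \<in> l2" by (rule l2_diff[OF \<theta>h l2])
  have T: "0 \<le> T" and h: "0 \<le> h"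
    using sqnorm_nonneg[OF l2_shift[OF \<delta>_l2]] by (auto simp: T_def h_def intro: sum_nonneg)
  have H_split: "H = (\<Sum>i<k. (\<theta>h i)\<^sup>2) + sqnorm (\<lambda>i. \<theta>h (i + k))"
    unfolding H_def by (rule sqnorm_split[OF \<theta>h])
  have tail: "0 \<le> sqnorm (\<lambda>i. \<theta>h (i + k))"
    by (rule sqnorm_nonneg[OF l2_shift[OF \<theta>h]])
  have "(\<Sum>i<k. (\<theta> i)\<^sup>2) = (\<Sum>i<k. (\<theta>h i)\<^sup>2 - 2 * (\<theta>h i * ?\<delta> i) + (?\<delta> i)\<^sup>2)"
    by (intro sum.cong) (auto simp: power2_eq_square algebra_simps)
  also have "\<dots> = (\<Sum>i<k. (\<theta>h i)\<^sup>2) - 2 * c + h"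
    by (simp add: c_def h_def sum.distrib sum_subtractf sum_distrib_left)
  finally have "(\<Sum>i<k. (\<theta> i)\<^sup>2) + sqnorm (\<lambda>i. \<theta>h (i + k)) = H - 2 * c + h"
    using H_split by simp
  then have x_mse: "mse n (Qhat2 n \<theta>h k) \<theta> = ennreal x"
    using mse_Qhat2[OF n l2 \<theta>h, of k] by (simp only: x_def T_def)
  have y_mse: "mse n (Qhat1 \<theta>h) \<theta> = ennreal y"
    using mse_Qhat1[OF n l2 \<theta>h] sqnorm_split[OF \<delta>_l2, of k] by (simp add: y_def T_def h_def H_def)
  have "c\<^sup>2 \<le> (\<Sum>i<k. (\<theta>h i)\<^sup>2) * h"
    unfolding c_def h_def by (rule Cauchy_Schwarz_ineq_sum)
  also have "\<dots> \<le> H * h"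
    using h tail H_split by (intro mult_right_mono) auto
  finally have c: "c\<^sup>2 \<le> H * h" .
  have x0: "0 \<le> x"
    using \<open>(\<Sum>i<k. (\<theta> i)\<^sup>2) + sqnorm (\<lambda>i. \<theta>h (i + k)) = H - 2 * c + h\<close>[symmetric] tail
    by (auto simp: x_def intro!: add_nonneg_nonneg mult_nonneg_nonneg divide_nonneg_nonneg sum_nonneg)
  have y0: "0 < y"
    using n h0 by (auto simp: y_def H_def intro!: add_nonneg_pos)
  have "x \<le> (1 + \<epsilon>) * y"
    unfolding x_def y_def using n T h h0 c \<epsilon> large
    by (intro mse_Qhat2_le[where ?h0.0 = h0]) (auto simp: H_def)
  then have "(x - y) / y \<le> \<epsilon>"
    using y0 by (simp add: divide_le_eq algebra_simps)
  then show ?thesis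
    using Delta_eq_ereal[OF x_mse y_mse x0 y0] by simp
qed

text \<open>A shift of the first coordinate towards zero by \<open>sqrt r\<close> removes the whole bias of
  \<open>Qhat1\<close> and does not increase the stochastic error by more than \<open>O(r / n + k / n\<^sup>2)\<close>.\<close>

lemma Delta_Qhat2_neg:
  assumes n: "0 < n" and \<theta>h: "\<theta>h \<in> l2" "0 < sqnorm \<theta>h" and k: "1 \<le> k" and r: "0 < r"
    and large: "C1 / real n \<le> r\<^sup>2" "64 \<le> C1 * real n" "real k / real n < C1 / 8"
  shows "\<exists>\<theta>\<in>P_SA \<theta>h r. Delta n (Qhat2 n \<theta>h k) (Qhat1 \<theta>h) \<theta> < 0"
proof -
  define \<delta> where "\<delta> i = (if i = 0 then (if 0 \<le> \<theta>h 0 then - sqrt r else sqrt r) else 0)" for i :: nat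
  let ?\<theta> = "\<lambda>i. \<theta>h i + \<delta> i"
  have \<delta>: "\<And>i. i \<notin> {0} \<Longrightarrow> \<delta> i = 0" "(\<delta> 0)\<^sup>2 = r" "\<theta>h 0 * \<delta> 0 \<le> 0"
    using r by (auto simp: \<delta>_def mult_nonneg_nonpos mult_nonpos_nonneg)
  have mem: "?\<theta> \<in> P_SA \<theta>h r"
    using \<delta> by (intro P_SA_add_finite_support[where J = "{0}"] \<theta>h) auto
  then have l2: "?\<theta> \<in> l2" by (simp add: P_SA_def)
  define x where "x = 4 / real n * ((\<Sum>i<k. (?\<theta> i)\<^sup>2) + sqnorm (\<lambda>i. \<theta>h (i + k))) + 4 * real k / (real n)\<^sup>2"
  define y where "y = r\<^sup>2 + 4 / real n * sqnorm \<theta>h"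
  \<comment> \<open>The shift sits at index 0, which the correction covers as soon as
    \<open>1 \<le> k\<close>.\<close>
  have "sqnorm (\<lambda>i. \<theta>h (i + k) - ?\<theta> (i + k)) = 0"
    using k \<delta>(1) by (simp add: sqnorm_def)
  then have x_mse: "mse n (Qhat2 n \<theta>h k) ?\<theta> = ennreal x"
    using mse_Qhat2[OF n l2 \<theta>h(1), of k] by (simp add: x_def)
  have "sqnorm (\<lambda>i. \<theta>h i - ?\<theta> i) = r"
    using finite_support_l2(2)[of "{0}" \<delta>] \<delta> by (simp add: sqnorm_def)
  then have y_mse: "mse n (Qhat1 \<theta>h) ?\<theta> = ennreal y"
    using mse_Qhat1[OF n l2 \<theta>h(1)] by (simp add: y_def)
  have x0: "0 \<le> x"
    using sqnorm_nonneg[OF l2_shift[OF \<theta>h(1)], of k]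
    by (auto simp: x_def intro!: add_nonneg_nonneg mult_nonneg_nonneg divide_nonneg_nonneg sum_nonneg)
  have y0: "0 < y"
    using n \<theta>h by (auto simp: y_def intro!: add_nonneg_pos)
  have "(\<Sum>i<k. (?\<theta> i)\<^sup>2) = (\<Sum>i<k. (\<theta>h i)\<^sup>2 + (if i = 0 then 2 * (\<theta>h 0 * \<delta> 0) + (\<delta> 0)\<^sup>2 else 0))"
    using \<delta>(1) by (intro sum.cong) (auto simp: power2_sum)
  also have "\<dots> \<le> (\<Sum>i<k. (\<theta>h i)\<^sup>2) + r"
    using k \<delta> by (simp add: sum.distrib mult.commute[of "\<delta> 0"])
  finally have "(\<Sum>i<k. (?\<theta> i)\<^sup>2) + sqnorm (\<lambda>i. \<theta>h (i + k)) \<le> sqnorm \<theta>h + r"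
    using sqnorm_split[OF \<theta>h(1), of k] by simp
  then have "4 / real n * ((\<Sum>i<k. (?\<theta> i)\<^sup>2) + sqnorm (\<lambda>i. \<theta>h (i + k))) \<le> 4 / real n * (sqnorm \<theta>h + r)"
    by (intro mult_left_mono) auto
  then have x_le: "x \<le> 4 / real n * sqnorm \<theta>h + 4 / real n * r + 4 * real k / (real n)\<^sup>2"
    by (simp add: x_def distrib_left)
  \<comment> \<open>The gain r^2 is spent in two halves. Together C1 / n \<le> r^2 and 64 \<le> C1 n
    give r \<ge> 8 / n, so 4 r / n takes at most one half; the k / n^2 term takes strictly less than
    the other, whence the strict inequality.\<close>
  have "(8 / real n)\<^sup>2 \<le> r\<^sup>2"
  proof -
    have "(8 / real n)\<^sup>2 \<le> C1 / real n"
      using n large(2) by (simp add: power2_eq_square field_simps)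
    then show ?thesis using large(1) by simp
  qed
  then have "8 / real n \<le> r"
    using r by (simp add: power2_le_iff_abs_le)
  then have "8 / real n * r \<le> r * r"
    using r by (intro mult_right_mono) auto
  moreover have "4 * real k / (real n)\<^sup>2 < r\<^sup>2 / 2"
  proof -
    have "4 * real k / (real n)\<^sup>2 = 4 / real n * (real k / real n)"
      by (simp add: power2_eq_square)
    also have "\<dots> < 4 / real n * (C1 / 8)"
      using n large(3) by (intro mult_strict_left_mono) auto
    also have "\<dots> \<le> r\<^sup>2 / 2"
      using large(1) by simp
    finally show ?thesis .
  qed
  ultimately have "x < y"
    using x_le by (simp add: y_def power2_eq_square)
  then have "(x - y) / y < 0"
    using y0 by (simp add: divide_less_0_iff)
  then show ?thesis
    using Delta_eq_ereal[OF x_mse y_mse x0 y0] mem by (intro bexI[of _ ?\<theta>]) simp_all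
qed

text \<open>The error is at most 5 r^2 + (12 + 8 / h0) H / n: the cross term 8 r / n becomes 4 r^2 +
  4 / n^2, and 4 / n^2 and 4 k / n^2 are each at most 4 / n, hence together at most 8 H / (n h0).
  The two lower bounds r^2 \<le> 6 \<rho> and H / n \<le> (8 / c) \<rho> then produce 30 = 5 * 6 and
  the remaining constant.\<close>

lemma mse_Qhat2_le_minimax_risk:
  assumes n: "0 < n" and \<theta>h: "\<theta>h \<in> l2" and h0: "0 < h0" "h0 \<le> sqnorm \<theta>h" and k: "k \<le> n"
    and c: "0 < c" "c \<le> 1" "c / real n \<le> r" and \<theta>: "\<theta> \<in> P_SA \<theta>h r"
  shows "mse n (Qhat2 n \<theta>h k) \<theta> \<le> ennreal (30 + (12 + 8 / h0) * (8 / c)) * minimax_risk n (P_SA \<theta>h r)"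
proof (cases "minimax_risk n (P_SA \<theta>h r)")
  case top
  have "0 < 30 + (12 + 8 / h0) * (8 / c)"
    using h0 c by (intro add_pos_pos mult_pos_pos) auto
  then show ?thesis
    unfolding top by (simp add: ennreal_mult_top)
next
  case (real \<rho>)
  have r: "0 < r"
    using c n by (meson divide_pos_pos less_le_trans of_nat_0_less_iff)
  let ?\<delta> = "\<lambda>i. \<theta>h i - \<theta> i"
  define T where "T = sqnorm (\<lambda>i. ?\<delta> (i + k))"
  define h where "h = (\<Sum>i<k. (?\<delta> i)\<^sup>2)"
  define H where "H = sqnorm \<theta>h"
  have l2: "\<theta> \<in> l2" and "sqnorm ?\<delta> \<le> r" using \<theta> by (auto simp: P_SA_def)
  have \<delta>_l2: "?\<delta> \<in> l2" by (rule l2_diff[OF \<theta>h l2])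
  have T: "0 \<le> T" and h: "0 \<le> h"
    using sqnorm_nonneg[OF l2_shift[OF \<delta>_l2]] by (auto simp: T_def h_def intro: sum_nonneg)
  have "h + T \<le> r"
    using sqnorm_split[OF \<delta>_l2, of k] \<open>sqnorm ?\<delta> \<le> r\<close> by (simp add: h_def T_def)
  have H_split: "H = (\<Sum>i<k. (\<theta>h i)\<^sup>2) + sqnorm (\<lambda>i. \<theta>h (i + k))"
    unfolding H_def by (rule sqnorm_split[OF \<theta>h])
  have "0 \<le> sqnorm (\<lambda>i. \<theta>h (i + k))"
    by (rule sqnorm_nonneg[OF l2_shift[OF \<theta>h]])
  moreover have "0 \<le> (\<Sum>i<k. (\<theta>h i)\<^sup>2)"
    by (intro sum_nonneg) simp
  moreover have "(\<Sum>i<k. (\<theta> i)\<^sup>2) \<le> (\<Sum>i<k. 2 * (\<theta>h i)\<^sup>2 + 2 * (?\<delta> i)\<^sup>2)"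
  proof (rule sum_mono)
    fix i
    have "0 \<le> (\<theta>h i + ?\<delta> i)\<^sup>2" by simp
    then show "(\<theta> i)\<^sup>2 \<le> 2 * (\<theta>h i)\<^sup>2 + 2 * (?\<delta> i)\<^sup>2"
      by (simp add: power2_eq_square algebra_simps)
  qed
  then have "(\<Sum>i<k. (\<theta> i)\<^sup>2) \<le> 2 * (\<Sum>i<k. (\<theta>h i)\<^sup>2) + 2 * h"
    by (simp add: sum.distrib sum_distrib_left h_def)
  ultimately have "(\<Sum>i<k. (\<theta> i)\<^sup>2) + sqnorm (\<lambda>i. \<theta>h (i + k)) \<le> 3 * H + 2 * r"
    using H_split \<open>h + T \<le> r\<close> T by linarith
  then have "4 / real n * ((\<Sum>i<k. (\<theta> i)\<^sup>2) + sqnorm (\<lambda>i. \<theta>h (i + k))) \<le> 4 / real n * (3 * H + 2 * r)"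
    by (intro mult_left_mono) auto
  moreover have "4 / real n * (3 * H + 2 * r) = 12 * (H / real n) + 8 * r / real n"
    using n by (simp add: field_simps)
  moreover have "8 * r / real n \<le> 4 * r\<^sup>2 + 4 / (real n)\<^sup>2"
    using sum_squares_bound[of "2 * r" "2 / real n"] by (simp add: power_mult_distrib power_divide)
  moreover have inv_le: "1 / real n \<le> H / real n / h0"
    using n h0 by (simp add: H_def field_simps)
  moreover have "4 / (real n)\<^sup>2 \<le> 4 / real n"
    using n by (simp add: field_simps power2_eq_square)
  moreover have "4 * real k / (real n)\<^sup>2 \<le> 4 / real n"
    using n k by (simp add: field_simps power2_eq_square)
  moreover have "T\<^sup>2 \<le> r\<^sup>2"
    using T h \<open>h + T \<le> r\<close> by (intro power_mono) auto
  ultimately have "T\<^sup>2 + 4 / real n * ((\<Sum>i<k. (\<theta> i)\<^sup>2) + sqnorm (\<lambda>i. \<theta>h (i + k))) + 4 * real k / (real n)\<^sup>2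
      \<le> 5 * r\<^sup>2 + 12 * (H / real n) + 8 * (H / real n / h0)"
    by linarith
  also have "\<dots> = 5 * r\<^sup>2 + (12 + 8 / h0) * (H / real n)"
    by (simp add: algebra_simps)
  also have "\<dots> \<le> 5 * (6 * \<rho>) + (12 + 8 / h0) * (8 / c * \<rho>)"
  proof (intro add_mono mult_left_mono)
    show "r\<^sup>2 \<le> 6 * \<rho>"
      using minimax_risk_ge_bias[OF n \<theta>h, of r] r real by simp
    have "c * H / (8 * real n) \<le> \<rho>"
      using minimax_risk_ge_parametric[OF n \<theta>h _ c] h0 real by (simp add: H_def)
    then show "H / real n \<le> 8 / c * \<rho>"
      using c n by (simp add: field_simps)
  qed (use h0 in auto)
  also have "\<dots> = (30 + (12 + 8 / h0) * (8 / c)) * \<rho>"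
    by (simp add: algebra_simps)
  finally have "mse n (Qhat2 n \<theta>h k) \<theta> \<le> ennreal ((30 + (12 + 8 / h0) * (8 / c)) * \<rho>)"
    using mse_Qhat2[OF n l2 \<theta>h, of k] by (simp add: T_def ennreal_leI)
  then show ?thesis
    using real h0 c by (simp add: ennreal_mult)
qed

section \<open>Limits in n, uniform over the admissible rates\<close>

lemma rate_ge: "rate C r \<Longrightarrow> 1 \<le> n \<Longrightarrow> C / real n \<le> r n"
  by (simp add: rate_def)

lemma rate_pos: "rate C r \<Longrightarrow> 0 < C \<Longrightarrow> 1 \<le> n \<Longrightarrow> 0 < r n"
  using rate_ge[of C r n] by (meson divide_pos_pos less_le_trans of_nat_0_less_iff zero_less_one)

lemma rate_const: "0 < R \<Longrightarrow> rate R (\<lambda>_. R)"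
  by (auto simp: rate_def monotone_on_def divide_le_eq mult_le_cancel_left1)

context
  fixes \<theta>h :: "nat \<Rightarrow> nat \<Rightarrow> real" and k :: "nat \<Rightarrow> nat" and h0 :: real
  assumes \<theta>h_l2: "\<And>n. \<theta>h n \<in> l2"
    and h0_pos: "h0 > 0"
    and \<theta>h_bounded_below: "\<forall>\<^sub>F n in sequentially. h0 \<le> sqnorm (\<theta>h n)"
    and k_small: "(\<lambda>n. real (k n)) \<in> o(\<lambda>n. real n)"
    and k_pos: "\<forall>\<^sub>F n in sequentially. 1 \<le> k n"
begin

lemma k_over_n_tendsto: "(\<lambda>n. real (k n) / real n) \<longlonglongrightarrow> 0"
  using k_small by (rule smalloD_tendsto)

lemma Qhat2_asymptotically_minimax:
  assumes C: "0 < C" and r: "rate C r"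
  shows "asymptotically_minimax (\<lambda>n. Qhat2 n (\<theta>h n) (k n)) (\<lambda>n. P_SA (\<theta>h n) (r n))"
proof -
  \<comment> \<open>The parametric lower bound uses a shift of squared size c / n with c \<le> 1, so
    a large \<open>C\<close> is capped; the cap only weakens the condition on
    \<open>r\<close>.\<close>
  define c where "c = min 1 C"
  have c: "0 < c" "c \<le> 1" "c \<le> C" using C by (auto simp: c_def)
  define K where "K = 30 + (12 + 8 / h0) * (8 / c)"
  have "0 < K"
    unfolding K_def using c h0_pos by (intro add_pos_pos mult_pos_pos) auto
  moreover have "eventually (\<lambda>n. real (k n) / real n < 1) sequentially"
    using order_tendstoD(2)[OF k_over_n_tendsto, of 1] by simp
  with \<theta>h_bounded_below eventually_ge_at_top[of 1]
  have "eventually (\<lambda>n. (SUP \<theta>\<in>P_SA (\<theta>h n) (r n). mse n (Qhat2 n (\<theta>h n) (k n)) \<theta>)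
      \<le> ennreal K * minimax_risk n (P_SA (\<theta>h n) (r n))) sequentially"
  proof eventually_elim
    case (elim n)
    have "c / real n \<le> C / real n"
      using c by (intro divide_right_mono) auto
    then have "c / real n \<le> r n"
      using rate_ge[OF r elim(2)] by linarith
    moreover have "k n \<le> n"
      using elim(2,3) by (simp add: divide_less_eq)
    ultimately show ?case
      unfolding K_def using elim c h0_pos \<theta>h_l2 by (intro SUP_least mse_Qhat2_le_minimax_risk) auto
  qed
  ultimately show ?thesis
    unfolding asymptotically_minimax_def eventually_sequentially using Qhat2_estimator by blast
qed

text \<open>The eventual conditions involve \<open>n\<close>, \<open>k\<close>,
  \<open>\<epsilon>\<close>, \<open>h0\<close> and \<open>C1\<close> but no radius, so the threshold
  can be chosen before the rate; \<open>0 < C\<close> makes every admissible radius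
  positive.\<close>

lemma eventually_Delta_le_and_neg:
  assumes C: "0 < C" and C1: "0 < C1" and \<epsilon>: "0 < \<epsilon>"
  shows "\<exists>N. \<forall>n\<ge>N. \<forall>r. rate C r \<longrightarrow>
    (SUP \<theta>\<in>P_SA (\<theta>h n) (r n). Delta n (Qhat2 n (\<theta>h n) (k n)) (Qhat1 (\<theta>h n)) \<theta>) \<le> ereal \<epsilon> \<and>
    ((r n)\<^sup>2 \<ge> C1 / real n \<longrightarrow>
      (INF \<theta>\<in>P_SA (\<theta>h n) (r n). Delta n (Qhat2 n (\<theta>h n) (k n)) (Qhat1 (\<theta>h n)) \<theta>) < 0)"
  unfolding eventually_sequentially[symmetric]
proof -
  have "(\<lambda>n. (1 + 2 / \<epsilon>)\<^sup>2 / real n + real (k n) / real n) \<longlonglongrightarrow> 0 + 0"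
    by (intro tendsto_add k_over_n_tendsto lim_const_over_n)
  then have "(\<lambda>n. ((1 + 2 / \<epsilon>)\<^sup>2 + real (k n)) / real n) \<longlonglongrightarrow> 0"
    by (simp add: add_divide_distrib)
  then have "eventually (\<lambda>n. ((1 + 2 / \<epsilon>)\<^sup>2 + real (k n)) / real n < \<epsilon> * h0 / 2) sequentially"
    using \<epsilon> h0_pos by (intro order_tendstoD) auto
  moreover have "eventually (\<lambda>n. real (k n) / real n < C1 / 8) sequentially"
    using C1 by (intro order_tendstoD(2)[OF k_over_n_tendsto]) auto
  moreover have "eventually (\<lambda>n. 64 \<le> C1 * real n) sequentially"
    using C1 by real_asymp
  ultimately show "eventually (\<lambda>n. \<forall>r. rate C r \<longrightarrow>
    (SUP \<theta>\<in>P_SA (\<theta>h n) (r n). Delta n (Qhat2 n (\<theta>h n) (k n)) (Qhat1 (\<theta>h n)) \<theta>) \<le> ereal \<epsilon> \<and>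
    ((r n)\<^sup>2 \<ge> C1 / real n \<longrightarrow>
      (INF \<theta>\<in>P_SA (\<theta>h n) (r n). Delta n (Qhat2 n (\<theta>h n) (k n)) (Qhat1 (\<theta>h n)) \<theta>) < 0)) sequentially"
    using \<theta>h_bounded_below k_pos eventually_ge_at_top[of 1]
  proof eventually_elim
    case (elim n)
    show ?case
    proof (intro allI impI conjI)
      fix r assume r: "rate C r"
      show "(SUP \<theta>\<in>P_SA (\<theta>h n) (r n). Delta n (Qhat2 n (\<theta>h n) (k n)) (Qhat1 (\<theta>h n)) \<theta>) \<le> ereal \<epsilon>"
        using elim \<epsilon> h0_pos \<theta>h_l2 by (intro SUP_least Delta_Qhat2_le[where ?h0.0 = h0]) auto
      assume "C1 / real n \<le> (r n)\<^sup>2"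
      then have "\<exists>\<theta>\<in>P_SA (\<theta>h n) (r n). Delta n (Qhat2 n (\<theta>h n) (k n)) (Qhat1 (\<theta>h n)) \<theta> < 0"
        using elim h0_pos \<theta>h_l2 rate_pos[OF r C, of n] by (intro Delta_Qhat2_neg[where ?C1.0 = C1]) auto
      then show "(INF \<theta>\<in>P_SA (\<theta>h n) (r n). Delta n (Qhat2 n (\<theta>h n) (k n)) (Qhat1 (\<theta>h n)) \<theta>) < 0"
        by (simp add: INF_less_iff)
    qed
  qed
qed

lemma Qhat1_asymptotically_inadmissible:
  assumes C: "0 < C" and C1: "0 < C1" and r: "rate C r" and r2: "\<forall>n\<ge>1. C1 / real n \<le> (r n)\<^sup>2"
  shows "asymptotically_inadmissible (\<lambda>n. Qhat1 (\<theta>h n)) (\<lambda>n. P_SA (\<theta>h n) (r n))"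
  unfolding asymptotically_inadmissible_def
proof (intro exI[of _ "\<lambda>n. Qhat2 n (\<theta>h n) (k n)"] conjI allI impI Qhat2_estimator)
  fix \<epsilon> :: real assume "0 < \<epsilon>"
  then obtain N where N: "\<And>n. n \<ge> N \<Longrightarrow>
    (SUP \<theta>\<in>P_SA (\<theta>h n) (r n). Delta n (Qhat2 n (\<theta>h n) (k n)) (Qhat1 (\<theta>h n)) \<theta>) \<le> ereal \<epsilon> \<and>
    ((r n)\<^sup>2 \<ge> C1 / real n \<longrightarrow>
      (INF \<theta>\<in>P_SA (\<theta>h n) (r n). Delta n (Qhat2 n (\<theta>h n) (k n)) (Qhat1 (\<theta>h n)) \<theta>) < 0)"
    using eventually_Delta_le_and_neg[OF C C1] r by blast
  show "\<exists>N. \<forall>n\<ge>N.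
      (SUP \<theta>\<in>P_SA (\<theta>h n) (r n). Delta n (Qhat2 n (\<theta>h n) (k n)) (Qhat1 (\<theta>h n)) \<theta>) \<le> ereal \<epsilon> \<and>
      (INF \<theta>\<in>P_SA (\<theta>h n) (r n). Delta n (Qhat2 n (\<theta>h n) (k n)) (Qhat1 (\<theta>h n)) \<theta>) < 0"
    using N r2 by (intro exI[of _ "max 1 N"]) auto
qed

end

theorem theorem1:
  fixes \<theta>h :: "nat \<Rightarrow> nat \<Rightarrow> real" and k :: "nat \<Rightarrow> nat" and h0 :: real
  assumes \<theta>h_l2: "\<And>n. \<theta>h n \<in> l2"
    and h0_pos: "h0 > 0"
    and \<theta>h_bounded_below: "\<forall>\<^sub>F n in sequentially. h0 \<le> sqnorm (\<theta>h n)"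
    and k_small: "(\<lambda>n. real (k n)) \<in> o(\<lambda>n. real n)"
    and k_pos: "\<forall>\<^sub>F n in sequentially. 1 \<le> k n"
  shows
    "(\<forall>C>0.
        (\<forall>r. rate C r \<longrightarrow>
           asymptotically_minimax (\<lambda>n. Qhat2 n (\<theta>h n) (k n)) (\<lambda>n. P_SA (\<theta>h n) (r n))) \<and>
        (\<forall>C1>0. \<forall>\<epsilon>::real. \<epsilon> > 0 \<longrightarrow> (\<exists>N. \<forall>n\<ge>N. \<forall>r. rate C r \<longrightarrow>
           (SUP \<theta>\<in>P_SA (\<theta>h n) (r n). Delta n (Qhat2 n (\<theta>h n) (k n)) (Qhat1 (\<theta>h n)) \<theta>) \<le> ereal \<epsilon> \<and>
           ((r n)\<^sup>2 \<ge> C1 / real n \<longrightarrow>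
             (INF \<theta>\<in>P_SA (\<theta>h n) (r n). Delta n (Qhat2 n (\<theta>h n) (k n)) (Qhat1 (\<theta>h n)) \<theta>) < 0))) \<and>
        (\<forall>C1>0. \<forall>r. rate C r \<and> (\<forall>n\<ge>1. (r n)\<^sup>2 \<ge> C1 / real n) \<longrightarrow>
           asymptotically_inadmissible (\<lambda>n. Qhat1 (\<theta>h n)) (\<lambda>n. P_SA (\<theta>h n) (r n)))) \<and>
     (\<forall>R>0.
        asymptotically_minimax (\<lambda>n. Qhat2 n (\<theta>h n) (k n)) (\<lambda>n. P_AL R (\<theta>h n)) \<and>
        (\<forall>\<epsilon>::real. \<epsilon> > 0 \<longrightarrow> (\<exists>N. \<forall>n\<ge>N.
           (SUP \<theta>\<in>P_AL R (\<theta>h n). Delta n (Qhat2 n (\<theta>h n) (k n)) (Qhat1 (\<theta>h n)) \<theta>) \<le> ereal \<epsilon> \<and>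
           (INF \<theta>\<in>P_AL R (\<theta>h n). Delta n (Qhat2 n (\<theta>h n) (k n)) (Qhat1 (\<theta>h n)) \<theta>) < 0)) \<and>
        asymptotically_inadmissible (\<lambda>n. Qhat1 (\<theta>h n)) (\<lambda>n. P_AL R (\<theta>h n)))"
proof -
  note minimax = Qhat2_asymptotically_minimax[OF assms]
    and compare = eventually_Delta_le_and_neg[OF assms]
    and inadmissible = Qhat1_asymptotically_inadmissible[OF assms]
  \<comment> \<open>A constant radius R is a rate with C = R and meets the condition for a strict
    gain with C1 = R^2 from n = 1 on. The assumption-lean claims are therefore instances of the
    structure-agnostic ones.\<close>
  have const: "R\<^sup>2 / real n \<le> R\<^sup>2" if "1 \<le> n" for R :: real and n
    using that by (simp add: divide_le_eq mult_le_cancel_left1)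
  have compare_AL: "\<exists>N. \<forall>n\<ge>N.
      (SUP \<theta>\<in>P_AL R (\<theta>h n). Delta n (Qhat2 n (\<theta>h n) (k n)) (Qhat1 (\<theta>h n)) \<theta>) \<le> ereal \<epsilon> \<and>
      (INF \<theta>\<in>P_AL R (\<theta>h n). Delta n (Qhat2 n (\<theta>h n) (k n)) (Qhat1 (\<theta>h n)) \<theta>) < 0"
    if R: "0 < R" and \<epsilon>: "0 < \<epsilon>" for R \<epsilon> :: real
  proof -
    obtain N where N: "\<And>n r. n \<ge> N \<Longrightarrow> rate R r \<Longrightarrow>
        (SUP \<theta>\<in>P_SA (\<theta>h n) (r n). Delta n (Qhat2 n (\<theta>h n) (k n)) (Qhat1 (\<theta>h n)) \<theta>) \<le> ereal \<epsilon> \<and>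
        ((r n)\<^sup>2 \<ge> R\<^sup>2 / real n \<longrightarrow>
          (INF \<theta>\<in>P_SA (\<theta>h n) (r n). Delta n (Qhat2 n (\<theta>h n) (k n)) (Qhat1 (\<theta>h n)) \<theta>) < 0)"
      using compare[OF R _ \<epsilon>, of "R\<^sup>2"] R by (metis zero_less_power)
    show ?thesis
      unfolding P_AL_def using N[OF _ rate_const[OF R]] const by (intro exI[of _ "max 1 N"]) auto
  qed
  have minimax_AL: "asymptotically_minimax (\<lambda>n. Qhat2 n (\<theta>h n) (k n)) (\<lambda>n. P_AL R (\<theta>h n))"
    if "0 < R" for R
    unfolding P_AL_def by (rule minimax[OF that rate_const[OF that]])
  have inadmissible_AL: "asymptotically_inadmissible (\<lambda>n. Qhat1 (\<theta>h n)) (\<lambda>n. P_AL R (\<theta>h n))"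
    if "0 < R" for R
    unfolding P_AL_def using that const by (intro inadmissible[OF that _ rate_const[OF that], of "R\<^sup>2"]) auto
  show ?thesis
    by (intro conjI allI impI)
      (elim conjE
        | rule minimax[rotated] compare inadmissible[rotated 2] minimax_AL compare_AL inadmissible_AL
        | assumption)+
qed

end
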